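(* Let $\mathfrak g$ be a $2k$-dimensional real filiform Lie algebra that is a filtered deformation of some $\mathbb N$-graded symplectic filiform Lie algebra $\mathfrak g_0$, and let $e_1,\dots,e_{2k}$ be an adapted basis of $\mathfrak g$ defining the filtration $L$ with ${\rm gr}_L\mathfrak g\cong\mathfrak g_0$. Let $E_r$ be the spectral sequence corresponding to the filtration $\tilde L$ of the cochain complex $\Lambda^*(\mathfrak g^* )$. Then $\mathfrak g$ is symplectic if and only if some homogeneous symplectic class $$[\omega_{2k+1}]\in E_1^{-2k-1,\,2k+3}=H^2_{(2k+1)}({\rm gr}_L\mathfrak g)$$ survives to the term $E_\infty$.
   Context: A filiform Lie algebra is an $n$-dimensional nilpotent Lie algebra of nil-index $n-1$. A Lie algebra is symplectic if it has a non-degenerate $2$-form closed for the Chevalley–Eilenberg differential $d$ (trivial coefficients). Adapted basis (here): a basis $e_1,\dots,e_n$ of $\mathfrak g$ with $[e_1,e_i]=e_{i+1}$ for $2\le i\le n-1$, $[e_i,e_j]=\sum_{l=0}^{n-i-j}c_{ij}^l e_{i+j+l}$ for $i+j\le n$, and $[e_i,e_j]=0$ for $i+j>n$. It defines the filtration $L^p\mathfrak g={\rm Span}(e_p,\dots,e_n)$; ${\rm gr}_L\mathfrak g=\bigoplus_pL^p\mathfrak g/L^{p+1}\mathfrak g$ is identified with the Lie algebra on the same basis with brackets $[e_i,e_j]=c^0_{ij}e_{i+j}$ ($i+j\le n$), $0$ otherwise, which is $\mathbb N$-graded filiform (one-dimensional components in degrees $1,\dots,n$, with $[\mathfrak g_1,\mathfrak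 g_i]=\mathfrak g_{i+1}$ for $i\ge2$); $\mathfrak g$ is called a filtered deformation of ${\rm gr}_L\mathfrak g$. Let $e^1,\dots,e^n$ be the dual basis. The monomial $e^{i_1}\wedge\dots\wedge e^{i_p}$ has weight $i_1+\dots+i_p$. The decreasing filtration $\tilde L$ of the complex $(\Lambda^*(\mathfrak g^* ),d)$ is: $\tilde L^\mu\Lambda^p(\mathfrak g^* )$ is spanned by the $p$-monomials of weight $\le-\mu$. For ${\rm gr}_L\mathfrak g$ the differential preserves the weight and $H^p_{(\lambda)}({\rm gr}_L\mathfrak g)$ denotes the weight-$\lambda$ part of $H^p({\rm gr}_L\mathfrak g)$. The spectral sequence of $\tilde L$ has $E_1^{p,q}=H^{p+q}_{(-p)}({\rm gr}_L\mathfrak g)$ and differentials $d_r:E_r^{p,q}\to E_r^{p+r,q-r+1}$. A homogeneous symplectic class is the class of a weight-$(2k+1)$ closed non-degenerate $2$-form on ${\rm gr}_L\mathfrak g$. A class in $E_1$ survives to $E_\infty$ if $d_r$ annihilates the class it represents in $E_r$ for every $r\ge1$. *)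

theory Defs
  imports
    "HOL-Analysis.Analysis"
    "HOL-Combinatorics.Permutations"
    "HOL-Library.Function_Algebras"
    "HOL-Library.Set_Algebras"
begin

section \<open>Filiform Lie algebras\<close>

definition lie_algebra :: "('a::real_vector \<Rightarrow> 'a \<Rightarrow> 'a) \<Rightarrow> bool" where
  "lie_algebra br \<longleftrightarrow>
     (\<forall>x. linear (\<lambda>y. br x y)) \<and> (\<forall>y. linear (\<lambda>x. br x y)) \<and>
     (\<forall>x. br x x = 0) \<and>
     (\<forall>x y z. br x (br y z) + br y (br z x) + br z (br x y) = 0)"

definition bracket_span :: "('a::real_vector \<Rightarrow> 'a \<Rightarrow> 'a) \<Rightarrow> 'a set \<Rightarrow> 'a set \<Rightarrow> 'a set" where
  "bracket_span br A B = span {br x y | x y. x \<in> A \<and> y \<in> B}"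

primrec lower_central :: "('a::real_vector \<Rightarrow> 'a \<Rightarrow> 'a) \<Rightarrow> nat \<Rightarrow> 'a set" where
  "lower_central br 0 = UNIV"
| "lower_central br (Suc s) = bracket_span br UNIV (lower_central br s)"

text \<open>The lower central series starts at index 0 with the whole algebra, so that a nonzero
  abelian algebra has nil-index 1.\<close>

definition has_nil_index :: "('a::real_vector \<Rightarrow> 'a \<Rightarrow> 'a) \<Rightarrow> nat \<Rightarrow> bool" where
  "has_nil_index br s \<longleftrightarrow> lower_central br s = {0} \<and> (\<forall>t<s. lower_central br t \<noteq> {0})"

text \<open>The condition \<open>s + 1 = n\<close> forces \<open>n > 0\<close>; then \<open>dim UNIV = n\<close> implies that the
  space is finite-dimensional (\<^const>\<open>dim\<close> is 0 on infinite-dimensional spaces).\<close>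

definition filiform :: "('a::real_vector \<Rightarrow> 'a \<Rightarrow> 'a) \<Rightarrow> nat \<Rightarrow> bool" where
  "filiform br n \<longleftrightarrow>
     lie_algebra br \<and> dim (UNIV :: 'a set) = n \<and> (\<exists>s. s + 1 = n \<and> has_nil_index br s)"

text \<open>\<open>G i\<close> is the component of degree \<open>i\<close>.\<close>

definition graded_filiform :: "('a::real_vector \<Rightarrow> 'a \<Rightarrow> 'a) \<Rightarrow> nat \<Rightarrow> (nat \<Rightarrow> 'a set) \<Rightarrow> bool" where
  "graded_filiform br n G \<longleftrightarrow>
     filiform br n \<and>
     (\<forall>i. subspace (G i)) \<and>
     (\<forall>i\<in>{1..n}. dim (G i) = 1) \<and>
     (\<forall>i. i \<notin> {1..n} \<longrightarrow> G i = {0}) \<and>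
     (\<forall>x. \<exists>!f. (\<forall>i. f i \<in> G i) \<and> x = (\<Sum>i=1..n. f i)) \<and>
     (\<forall>i j. bracket_span br (G i) (G j) \<subseteq> G (i + j)) \<and>
     (\<forall>i\<ge>2. bracket_span br (G 1) (G i) = G (i + 1))"

section \<open>Adapted bases and the associated graded algebra\<close>

definition adapted_basis :: "('a::real_vector \<Rightarrow> 'a \<Rightarrow> 'a) \<Rightarrow> nat \<Rightarrow> (nat \<Rightarrow> 'a) \<Rightarrow> bool" where
  "adapted_basis br n e \<longleftrightarrow>
     inj_on e {1..n} \<and> independent (e ` {1..n}) \<and> span (e ` {1..n}) = UNIV \<and>
     (\<forall>i. 2 \<le> i \<and> i + 1 \<le> n \<longrightarrow> br (e 1) (e i) = e (i + 1)) \<and>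
     (\<forall>i\<in>{1..n}. \<forall>j\<in>{1..n}. i + j \<le> n \<longrightarrow>
        (\<exists>c :: nat \<Rightarrow> real. br (e i) (e j) = (\<Sum>l=0..n-i-j. c l *\<^sub>R e (i + j + l)))) \<and>
     (\<forall>i\<in>{1..n}. \<forall>j\<in>{1..n}. i + j > n \<longrightarrow> br (e i) (e j) = 0)"

definition dual_basis :: "nat \<Rightarrow> (nat \<Rightarrow> 'a::real_vector) \<Rightarrow> nat \<Rightarrow> 'a \<Rightarrow> real" where
  "dual_basis n e i x = representation (e ` {1..n}) x (e i)"

text \<open>The associated graded algebra for the filtration by the spans of \<open>e p, \<dots>, e n\<close>, carried by
  the same vector space: \<open>dual_basis n e (i + j) (br (e i) (e j))\<close> is the structure constant of
  \<open>e (i + j)\<close> in the bracket of \<open>e i\<close> and \<open>e j\<close>, and all other structure constants are dropped.\<close>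

definition gr_bracket ::
  "('a::real_vector \<Rightarrow> 'a \<Rightarrow> 'a) \<Rightarrow> nat \<Rightarrow> (nat \<Rightarrow> 'a) \<Rightarrow> 'a \<Rightarrow> 'a \<Rightarrow> 'a" where
  "gr_bracket br n e x y =
     (\<Sum>i\<in>{1..n}. \<Sum>j\<in>{1..n-i}.
        (dual_basis n e i x * dual_basis n e j y * dual_basis n e (i + j) (br (e i) (e j)))
          *\<^sub>R e (i + j))"

text \<open>Isomorphism of graded Lie algebras from the associated graded algebra, with components
  spanned by the \<open>e i\<close>, onto \<open>(br0, G)\<close>.\<close>

definition gr_isomorphic ::
  "('a::real_vector \<Rightarrow> 'a \<Rightarrow> 'a) \<Rightarrow> nat \<Rightarrow> (nat \<Rightarrow> 'a) \<Rightarrow>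
   ('b::real_vector \<Rightarrow> 'b \<Rightarrow> 'b) \<Rightarrow> (nat \<Rightarrow> 'b set) \<Rightarrow> bool" where
  "gr_isomorphic br n e br0 G \<longleftrightarrow>
     (\<exists>f. linear f \<and> bij f \<and>
          (\<forall>x y. f (gr_bracket br n e x y) = br0 (f x) (f y)) \<and>
          (\<forall>i\<in>{1..n}. f ` span {e i} = G i))"

section \<open>The Chevalley--Eilenberg complex\<close>

text \<open>A cochain of degree \<open>p\<close> is a function on lists of vectors vanishing on all lists whose
  length is not \<open>p\<close>. Degrees are integers; in negative degree the only cochain is 0.\<close>

type_synonym 'a cochain = "'a list \<Rightarrow> real"

definition scale_cochain :: "real \<Rightarrow> 'a cochain \<Rightarrow> 'a cochain" where
  "scale_cochain c \<omega> = (\<lambda>xs. c * \<omega> xs)"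

global_interpretation cochain: vector_space scale_cochain
  by standard (auto simp: scale_cochain_def fun_eq_iff algebra_simps)

definition alternating_forms :: "int \<Rightarrow> 'a::real_vector cochain set" where
  "alternating_forms p =
     {\<omega>. (\<forall>xs. int (length xs) \<noteq> p \<longrightarrow> \<omega> xs = 0) \<and>
          (\<forall>xs i. i < length xs \<longrightarrow> linear (\<lambda>x. \<omega> (xs[i := x]))) \<and>
          (\<forall>xs. \<not> distinct xs \<longrightarrow> \<omega> xs = 0)}"

text \<open>Trivial coefficients; \<open>nths xs (- {i, j})\<close> is \<open>xs\<close> without its entries at the positions
  \<open>i\<close> and \<open>j\<close>. On 1-forms this is \<open>(d\<alpha>)(x, y) = - \<alpha>([x, y])\<close>.\<close>

definition CE_diff :: "('a::real_vector \<Rightarrow> 'a \<Rightarrow> 'a) \<Rightarrow> 'a cochain \<Rightarrow> 'a cochain" where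
  "CE_diff br \<omega> = (\<lambda>xs. \<Sum>j<length xs. \<Sum>i<j.
      (-1) ^ (i + j) * \<omega> (br (xs ! i) (xs ! j) # nths xs (- {i, j})))"

definition nondegenerate :: "'a::real_vector cochain \<Rightarrow> bool" where
  "nondegenerate \<omega> \<longleftrightarrow> (\<forall>x. (\<forall>y. \<omega> [x, y] = 0) \<longrightarrow> x = 0)"

definition symplectic :: "('a::real_vector \<Rightarrow> 'a \<Rightarrow> 'a) \<Rightarrow> bool" where
  "symplectic br \<longleftrightarrow>
     (\<exists>\<omega>\<in>alternating_forms 2. nondegenerate \<omega> \<and> CE_diff br \<omega> = 0)"

definition wedge :: "('a \<Rightarrow> real) list \<Rightarrow> 'a cochain" where
  "wedge \<phi>s = (\<lambda>xs. if length xs = length \<phi>s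
     then \<Sum>\<sigma> | \<sigma> permutes {..<length \<phi>s}.
            of_int (sign \<sigma>) * (\<Prod>a<length \<phi>s. (\<phi>s ! a) (xs ! \<sigma> a))
     else 0)"

text \<open>Monomials of degree \<open>p\<close> whose weight (sum of indices) satisfies \<open>P\<close>.\<close>

definition monomials ::
  "nat \<Rightarrow> (nat \<Rightarrow> 'a::real_vector) \<Rightarrow> int \<Rightarrow> (int \<Rightarrow> bool) \<Rightarrow> 'a cochain set" where
  "monomials n e p P =
     {wedge (map (dual_basis n e) is) | is.
        sorted_wrt (<) is \<and> set is \<subseteq> {1..n} \<and> int (length is) = p \<and> P (int (sum_list is))}"

definition weight_filtration ::
  "nat \<Rightarrow> (nat \<Rightarrow> 'a::real_vector) \<Rightarrow> int \<Rightarrow> int \<Rightarrow> 'a cochain set" where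
  "weight_filtration n e \<mu> p = cochain.span (monomials n e p (\<lambda>w. w \<le> - \<mu>))"

definition weight_forms ::
  "nat \<Rightarrow> (nat \<Rightarrow> 'a::real_vector) \<Rightarrow> int \<Rightarrow> int \<Rightarrow> 'a cochain set" where
  "weight_forms n e p \<nu> = cochain.span (monomials n e p (\<lambda>w. w = \<nu>))"

section \<open>Weight components of the cohomology of the associated graded algebra\<close>

definition gr_cohomology_class ::
  "('a::real_vector \<Rightarrow> 'a \<Rightarrow> 'a) \<Rightarrow> nat \<Rightarrow> (nat \<Rightarrow> 'a) \<Rightarrow> int \<Rightarrow> int \<Rightarrow> 'a cochain \<Rightarrow> 'a cochain set" where
  "gr_cohomology_class br n e p \<nu> \<omega> =
     \<omega> +o CE_diff (gr_bracket br n e) ` weight_forms n e (p - 1) \<nu>"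

definition gr_cohomology ::
  "('a::real_vector \<Rightarrow> 'a \<Rightarrow> 'a) \<Rightarrow> nat \<Rightarrow> (nat \<Rightarrow> 'a) \<Rightarrow> int \<Rightarrow> int \<Rightarrow> 'a cochain set set" where
  "gr_cohomology br n e p \<nu> =
     gr_cohomology_class br n e p \<nu> `
       {\<omega> \<in> weight_forms n e p \<nu>. CE_diff (gr_bracket br n e) \<omega> = 0}"

definition homogeneous_symplectic_class ::
  "('a::real_vector \<Rightarrow> 'a \<Rightarrow> 'a) \<Rightarrow> nat \<Rightarrow> (nat \<Rightarrow> 'a) \<Rightarrow> 'a cochain set \<Rightarrow> bool" where
  "homogeneous_symplectic_class br k e c \<longleftrightarrow>
     c \<in> gr_cohomology br (2 * k) e 2 (2 * int k + 1) \<and>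
     (\<exists>\<omega> \<in> weight_forms (2 * k) e 2 (2 * int k + 1).
        CE_diff (gr_bracket br (2 * k) e) \<omega> = 0 \<and> nondegenerate \<omega> \<and>
        c = gr_cohomology_class br (2 * k) e 2 (2 * int k + 1) \<omega>)"

section \<open>The spectral sequence of a filtered cochain complex\<close>

text \<open>\<open>F p m\<close> is the \<open>p\<close>-th step of a decreasing filtration of the degree \<open>m\<close> cochains and \<open>d\<close>
  the differential. The page \<open>r\<close> at position \<open>(p, q)\<close> is \<open>ss_Z F d r p q / ss_B F d r p q\<close>, as a
  set of cosets; \<open>ss_B\<close> is the full denominator
  \<open>Z\<^sub>r\<^sub>-\<^sub>1\<^sup>p\<^sup>+\<^sup>1\<^sup>,\<^sup>q\<^sup>-\<^sup>1 + d Z\<^sub>r\<^sub>-\<^sub>1\<^sup>p\<^sup>-\<^sup>r\<^sup>+\<^sup>1\<^sup>,\<^sup>q\<^sup>+\<^sup>r\<^sup>-\<^sup>2\<close>, and it is the zero of the page.\<close>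

definition ss_Z ::
  "(int \<Rightarrow> int \<Rightarrow> 'v::ab_group_add set) \<Rightarrow> ('v \<Rightarrow> 'v) \<Rightarrow> int \<Rightarrow> int \<Rightarrow> int \<Rightarrow> 'v set" where
  "ss_Z F d r p q = {x \<in> F p (p + q). d x \<in> F (p + r) (p + q + 1)}"

definition ss_B ::
  "(int \<Rightarrow> int \<Rightarrow> 'v::ab_group_add set) \<Rightarrow> ('v \<Rightarrow> 'v) \<Rightarrow> int \<Rightarrow> int \<Rightarrow> int \<Rightarrow> 'v set" where
  "ss_B F d r p q =
     ss_Z F d (r - 1) (p + 1) (q - 1) + d ` ss_Z F d (r - 1) (p - r + 1) (q + r - 2)"

definition ss_class ::
  "(int \<Rightarrow> int \<Rightarrow> 'v::ab_group_add set) \<Rightarrow> ('v \<Rightarrow> 'v) \<Rightarrow> int \<Rightarrow> int \<Rightarrow> int \<Rightarrow> 'v \<Rightarrow> 'v set" where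
  "ss_class F d r p q x = x +o ss_B F d r p q"

definition ss_page ::
  "(int \<Rightarrow> int \<Rightarrow> 'v::ab_group_add set) \<Rightarrow> ('v \<Rightarrow> 'v) \<Rightarrow> int \<Rightarrow> int \<Rightarrow> int \<Rightarrow> 'v set set" where
  "ss_page F d r p q = ss_class F d r p q ` ss_Z F d r p q"

text \<open>All members of a coset \<open>X\<close> yield the same coset on the right-hand side, so this union is
  a single coset; likewise in the next definition.\<close>

definition ss_diff ::
  "(int \<Rightarrow> int \<Rightarrow> 'v::ab_group_add set) \<Rightarrow> ('v \<Rightarrow> 'v) \<Rightarrow> int \<Rightarrow> int \<Rightarrow> int \<Rightarrow> 'v set \<Rightarrow> 'v set" where
  "ss_diff F d r p q X = (\<Union>x\<in>X. ss_class F d r (p + r) (q - r + 1) (d x))"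

text \<open>The class on page \<open>r + 1\<close> represented by a class \<open>X\<close> on page \<open>r\<close> in the kernel of the
  differential: the latter condition says that \<open>X\<close> meets \<open>ss_Z F d (r + 1) p q\<close>.\<close>

definition ss_next ::
  "(int \<Rightarrow> int \<Rightarrow> 'v::ab_group_add set) \<Rightarrow> ('v \<Rightarrow> 'v) \<Rightarrow> int \<Rightarrow> int \<Rightarrow> int \<Rightarrow> 'v set \<Rightarrow> 'v set" where
  "ss_next F d r p q X = (\<Union>x \<in> X \<inter> ss_Z F d (r + 1) p q. ss_class F d (r + 1) p q x)"

definition ss_survives ::
  "(int \<Rightarrow> int \<Rightarrow> 'v::ab_group_add set) \<Rightarrow> ('v \<Rightarrow> 'v) \<Rightarrow> int \<Rightarrow> int \<Rightarrow> 'v set \<Rightarrow> bool" where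
  "ss_survives F d p q c \<longleftrightarrow>
     c \<in> ss_page F d 1 p q \<and>
     (\<exists>X :: int \<Rightarrow> 'v set. X 1 = c \<and>
        (\<forall>r\<ge>1. ss_diff F d r p q (X r) = ss_B F d r (p + r) (q - r + 1) \<and>
                X (r + 1) = ss_next F d r p q (X r)))"

text \<open>The identification of the weight \<open>- p\<close> part of the cohomology of the associated graded
  algebra in degree \<open>p + q\<close> with the position \<open>(p, q)\<close> of the first page.\<close>

definition gr_to_E1 ::
  "('a::real_vector \<Rightarrow> 'a \<Rightarrow> 'a) \<Rightarrow> nat \<Rightarrow> (nat \<Rightarrow> 'a) \<Rightarrow> int \<Rightarrow> int \<Rightarrow> 'a cochain set \<Rightarrow> 'a cochain set" where
  "gr_to_E1 br n e p q c = (\<Union>\<omega>\<in>c. ss_class (weight_filtration n e) (CE_diff br) 1 p q \<omega>)"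

end

theory Submission
  imports Defs
begin

text \<open>Write \<open>n = 2 k\<close>. Evaluating the cocycle identity on \<open>e 1, e i, e j\<close> shows that a closed
  2-form on the filiform algebra has no component of weight above \<open>n + 1\<close>. Hence its Gram matrix
  vanishes beyond the antidiagonal, the form is non-degenerate iff its weight \<open>n + 1\<close> component is,
  and that component is closed for the graded algebra. All 1-forms have weight at most \<open>n\<close>, so the
  class of a weight \<open>n + 1\<close> form is a singleton and all coboundaries of degree 2 have weight at
  most \<open>n\<close>. Therefore such a class survives iff adding forms of weight at most \<open>n\<close> makes it closed,
  and these additions do not affect non-degeneracy.\<close>

section \<open>Survival in the spectral sequence\<close>

text \<open>Survival concerns a sequence of cosets, one for each page, and moving to the next page
  may replace the representative modulo the denominator of that page. Two facts keep this under
  control. The denominators at the position in question all lie in one additive set, the forms of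
  weight at most \<open>n\<close>, so however many pages are passed, the representative keeps its
  component of weight \<open>n + 1\<close>. And the filtration of the 3-forms reaches 0 after
  finitely many steps, so a representative on a late enough page is a genuine cocycle. Weight
  \<open>n + 1\<close> is the threshold because the cocycle identity on \<open>e 1, e i, e j\<close>
  is sure to lose its third term when \<open>i + j > n\<close>, and then it links neighbouring Gram
  entries of weight \<open>i + j + 1 > n + 1\<close>. Evenness of \<open>n\<close> settles weight
  \<open>n + 2\<close>, whose antidiagonal then passes through a diagonal entry.\<close>

locale filtered_complex =
  fixes F :: "int \<Rightarrow> int \<Rightarrow> 'v::ab_group_add set" and d :: "'v \<Rightarrow> 'v"
  assumes F_zero: "0 \<in> F p m"
    and F_diff: "x \<in> F p m \<Longrightarrow> y \<in> F p m \<Longrightarrow> x - y \<in> F p m"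
    and F_mono: "p \<le> p' \<Longrightarrow> F p' m \<subseteq> F p m"
    and d_diff: "d (x - y) = d x - d y"
begin

lemma d_zero: "d 0 = 0"
  using d_diff[of 0 0] by simp

lemma d_minus: "d (- x) = - d x"
  using d_diff[of 0 x] by (simp add: d_zero)

lemma d_add: "d (x + y) = d x + d y"
  using d_diff[of x "- y"] by (simp add: d_minus)

lemma ss_Z_zero: "0 \<in> ss_Z F d r p q"
  by (simp add: ss_Z_def d_zero F_zero)

lemma ss_Z_diff: "x \<in> ss_Z F d r p q \<Longrightarrow> y \<in> ss_Z F d r p q \<Longrightarrow> x - y \<in> ss_Z F d r p q"
  by (simp add: ss_Z_def d_diff F_diff)

lemma ss_B_iff:
  "x \<in> ss_B F d r p q \<longleftrightarrow>
     (\<exists>z\<in>ss_Z F d (r - 1) (p + 1) (q - 1).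
      \<exists>y\<in>ss_Z F d (r - 1) (p - r + 1) (q + r - 2). x = z + d y)"
  unfolding ss_B_def by (auto elim!: set_plus_elim)

lemma ss_B_zero: "0 \<in> ss_B F d r p q"
  unfolding ss_B_iff using ss_Z_zero d_zero by force

lemma ss_B_diff:
  assumes "x \<in> ss_B F d r p q" "y \<in> ss_B F d r p q"
  shows "x - y \<in> ss_B F d r p q"
proof -
  obtain z u z' u' where *: "z \<in> ss_Z F d (r - 1) (p + 1) (q - 1)"
    "u \<in> ss_Z F d (r - 1) (p - r + 1) (q + r - 2)" "x = z + d u"
    "z' \<in> ss_Z F d (r - 1) (p + 1) (q - 1)"
    "u' \<in> ss_Z F d (r - 1) (p - r + 1) (q + r - 2)" "y = z' + d u'"
    using assms unfolding ss_B_iff by blast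
  have "x - y = (z - z') + d (u - u')"
    using * by (simp add: d_diff)
  with * show ?thesis
    unfolding ss_B_iff using ss_Z_diff by meson
qed

lemma ss_B_add:
  "x \<in> ss_B F d r p q \<Longrightarrow> y \<in> ss_B F d r p q \<Longrightarrow> x + y \<in> ss_B F d r p q"
  using ss_B_diff[of x r p q "0 - y"] ss_B_diff[of 0 r p q y] ss_B_zero by simp

lemma ss_class_eq:
  assumes "x - y \<in> ss_B F d r p q"
  shows "ss_class F d r p q x = ss_class F d r p q y"
proof -
  have "ss_class F d r p q a \<subseteq> ss_class F d r p q b" if "a - b \<in> ss_B F d r p q" for a b
  proof
    fix v assume "v \<in> ss_class F d r p q a"
    then obtain u where "u \<in> ss_B F d r p q" "v = a + u"
      by (auto simp: ss_class_def elt_set_plus_def)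
    then have "v = b + ((a - b) + u)" "(a - b) + u \<in> ss_B F d r p q"
      using ss_B_add that by auto
    then show "v \<in> ss_class F d r p q b"
      unfolding ss_class_def elt_set_plus_def by blast
  qed
  from this[of x y] this[of y x] assms ss_B_diff[OF ss_B_zero assms]
  show ?thesis by auto
qed

lemma ss_class_self: "x \<in> ss_class F d r p q x"
  unfolding ss_class_def elt_set_plus_def using ss_B_zero by force

lemma ss_class_zero: "ss_class F d r p q 0 = ss_B F d r p q"
  by (simp add: ss_class_def)

lemma mem_ss_class_iff: "x \<in> ss_class F d r p q y \<longleftrightarrow> x - y \<in> ss_B F d r p q"
  by (auto simp: ss_class_def elt_set_plus_def intro!: bexI[of _ "x - y"])

text \<open>In \<open>x = z + d y\<close> the part \<open>d y\<close> dies and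
  \<open>d x = d z\<close>, where \<open>z\<close> lies in exactly the \<open>ss_Z\<close> whose
  image is the second summand of the denominator at the target. Hence the differential of a page is
  independent of the representative. The premise on \<open>d (d x)\<close> concerns degree
  \<open>m - 1\<close>, that of \<open>y\<close>; for 2-forms it is the Jacobi identity read on
  1-forms.\<close>

lemma d_ss_B:
  assumes dd: "\<And>p x. x \<in> F p (m - 1) \<Longrightarrow> d (d x) = 0" and "p + q = m"
    and "x \<in> ss_B F d r p q"
  shows "d x \<in> ss_B F d r (p + r) (q - r + 1)"
proof -
  obtain z y where z: "z \<in> ss_Z F d (r - 1) (p + 1) (q - 1)"
    and y: "y \<in> ss_Z F d (r - 1) (p - r + 1) (q + r - 2)" and x: "x = z + d y"
    using assms(3) unfolding ss_B_iff by blast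
  have "y \<in> F (p - r + 1) (m - 1)"
    using y assms(2) by (auto simp: ss_Z_def algebra_simps)
  then have "d x = 0 + d z"
    by (simp add: x d_add dd)
  moreover have "z \<in> ss_Z F d (r - 1) (p + r - r + 1) (q - r + 1 + r - 2)"
    using z by (simp add: algebra_simps)
  ultimately show ?thesis
    unfolding ss_B_iff using ss_Z_zero by blast
qed

text \<open>This makes the passage to the next page independent of the representative. In
  \<open>x = z + d y\<close> one has \<open>d z = d x\<close>, so the extra filtration step known
  for \<open>d x\<close> carries over to \<open>z\<close>, and \<open>y\<close> may be regarded as
  an element one filtration step lower.\<close>

lemma ss_B_Int_ss_Z:
  assumes dd: "\<And>p x. x \<in> F p (m - 1) \<Longrightarrow> d (d x) = 0" and "p + q = m"
    and "x \<in> ss_B F d r p q" "x \<in> ss_Z F d (r + 1) p q"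
  shows "x \<in> ss_B F d (r + 1) p q"
proof -
  obtain z y where z: "z \<in> ss_Z F d (r - 1) (p + 1) (q - 1)"
    and y: "y \<in> ss_Z F d (r - 1) (p - r + 1) (q + r - 2)" and x: "x = z + d y"
    using assms(3) unfolding ss_B_iff by blast
  have yF: "y \<in> F (p - r + 1) (m - 1)"
    using y assms(2) by (auto simp: ss_Z_def algebra_simps)
  then have "d z = d x"
    by (simp add: x d_add dd)
  then have "z \<in> ss_Z F d (r + 1 - 1) (p + 1) (q - 1)"
    using z assms(4) by (simp add: ss_Z_def algebra_simps)
  moreover have "y \<in> F (p - r) (m - 1)"
    using yF F_mono[of "p - r" "p - r + 1"] by auto
  then have "y \<in> ss_Z F d (r + 1 - 1) (p - (r + 1) + 1) (q + (r + 1) - 2)"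
    using y assms(2) by (auto simp: ss_Z_def algebra_simps)
  ultimately show ?thesis
    unfolding ss_B_iff using x by blast
qed

text \<open>A cocycle lies in every \<open>ss_Z\<close>, so its own cosets serve as the sequence of
  page classes; the two preceding lemmas evaluate the unions in \<open>ss_diff\<close> and
  \<open>ss_next\<close>.\<close>

lemma ss_survives_of_cocycle:
  assumes dd: "\<And>p x. x \<in> F p (m - 1) \<Longrightarrow> d (d x) = 0" and m: "p + q = m"
    and \<omega>: "\<omega> \<in> F p m" "d \<omega> = 0"
  shows "ss_survives F d p q (ss_class F d 1 p q \<omega>)"
  unfolding ss_survives_def
proof (intro conjI exI[of _ "\<lambda>r. ss_class F d r p q \<omega>"] allI impI refl)
  have Z: "\<omega> \<in> ss_Z F d r p q" for r
    using \<omega> m by (simp add: ss_Z_def F_zero)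
  show "ss_class F d 1 p q \<omega> \<in> ss_page F d 1 p q"
    unfolding ss_page_def using Z by blast
  fix r :: int
  assume "r \<ge> 1"
  have "ss_class F d r (p + r) (q - r + 1) (d x) = ss_B F d r (p + r) (q - r + 1)"
    if "x \<in> ss_class F d r p q \<omega>" for x
  proof -
    have "d (x - \<omega>) \<in> ss_B F d r (p + r) (q - r + 1)"
      using that d_ss_B[OF dd m] by (simp add: mem_ss_class_iff)
    then show ?thesis
      using ss_class_eq[of "d x" 0] by (simp add: d_diff \<omega> ss_class_zero)
  qed
  then show "ss_diff F d r p q (ss_class F d r p q \<omega>) = ss_B F d r (p + r) (q - r + 1)"
    unfolding ss_diff_def using ss_class_self[of \<omega> r p q]
    by (subst SUP_eq_const[of _ _ "ss_B F d r (p + r) (q - r + 1)"]) auto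
  have eq: "ss_class F d (r + 1) p q x = ss_class F d (r + 1) p q \<omega>"
    if "x \<in> ss_class F d r p q \<omega>" "x \<in> ss_Z F d (r + 1) p q" for x
  proof (rule ss_class_eq, rule ss_B_Int_ss_Z[OF dd m])
    show "x - \<omega> \<in> ss_B F d r p q"
      using that by (simp add: mem_ss_class_iff)
    show "x - \<omega> \<in> ss_Z F d (r + 1) p q"
      using that Z ss_Z_diff by blast
  qed
  have "\<omega> \<in> ss_class F d r p q \<omega> \<inter> ss_Z F d (r + 1) p q"
    using Z ss_class_self by blast
  then show "ss_class F d (r + 1) p q \<omega> = ss_next F d r p q (ss_class F d r p q \<omega>)"
    unfolding ss_next_def by (intro sym[OF SUP_eq_const] eq) blast+
qed

text \<open>The set \<open>U\<close> bounds the total drift of the representative over all pages,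
  and \<open>N\<close> is a page on which the filtration at the target has run out.\<close>

lemma cocycle_of_ss_survives:
  assumes surv: "ss_survives F d p q (ss_class F d 1 p q \<omega>)"
    and U: "\<And>x y. x \<in> U \<Longrightarrow> y \<in> U \<Longrightarrow> x + y \<in> U" "\<And>r. r \<ge> 1 \<Longrightarrow> ss_B F d r p q \<subseteq> U"
    and N: "N \<ge> 2" "F (p + N) (p + q + 1) \<subseteq> {0}"
  obtains x where "x \<in> F p (p + q)" "d x = 0" "x - \<omega> \<in> U"
proof -
  obtain X where X1: "X 1 = ss_class F d 1 p q \<omega>"
    and ker: "\<And>r. r \<ge> 1 \<Longrightarrow> ss_diff F d r p q (X r) = ss_B F d r (p + r) (q - r + 1)"
    and nxt: "\<And>r. r \<ge> 1 \<Longrightarrow> X (r + 1) = ss_next F d r p q (X r)"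
    using surv unfolding ss_survives_def by blast
  have sub: "x - \<omega> \<in> U" if "x \<in> X r" "r \<ge> 1" for x r
    using that(2,1)
  proof (induction r arbitrary: x rule: int_ge_induct)
    case base
    then show ?case
      using X1 U(2)[of 1] by (auto simp: mem_ss_class_iff)
  next
    case (step r)
    obtain y where y: "y \<in> X r" "x - y \<in> ss_B F d (r + 1) p q"
      using step.prems step.hyps by (auto simp: nxt ss_next_def mem_ss_class_iff)
    have "(x - y) + (y - \<omega>) \<in> U"
      using y step.IH U(2)[of "r + 1"] step.hyps by (intro U(1)) auto
    then show ?case by simp
  qed
  \<comment> \<open>An empty \<open>X N\<close> would have an empty image under
    \<open>ss_diff\<close>, whereas the kernel condition makes that image an \<open>ss_B\<close>,
    which contains 0. Being non-empty, \<open>X N\<close> forces \<open>X (N - 1)\<close> to meet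
    \<open>ss_Z\<close> of index \<open>N\<close>; \<open>N \<ge> 2\<close> makes
    \<open>N - 1\<close> a page of the sequence.\<close>
  have "X N \<noteq> {}"
    using ker[of N] N(1) ss_B_zero by (force simp: ss_diff_def)
  then obtain x where x: "x \<in> X (N - 1)" "x \<in> ss_Z F d N p q"
    using nxt[of "N - 1"] N(1) by (auto simp: ss_next_def)
  show thesis
    using that[of x] x N sub[of x "N - 1"] by (auto simp: ss_Z_def)
qed

end

section \<open>Alternating forms and monomials\<close>

lemma alternating_forms_length:
  "\<omega> \<in> alternating_forms p \<Longrightarrow> int (length xs) \<noteq> p \<Longrightarrow> \<omega> xs = 0"
  by (simp add: alternating_forms_def)

lemma alternating_forms_linear:
  "\<omega> \<in> alternating_forms p \<Longrightarrow> i < length xs \<Longrightarrow> linear (\<lambda>x. \<omega> (xs[i := x]))"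
  by (simp add: alternating_forms_def)

lemma alternating_forms_not_distinct:
  "\<omega> \<in> alternating_forms p \<Longrightarrow> \<not> distinct xs \<Longrightarrow> \<omega> xs = 0"
  by (simp add: alternating_forms_def)

lemma alternating_forms_add:
  assumes "\<omega> \<in> alternating_forms p" "\<eta> \<in> alternating_forms p"
  shows "\<omega> + \<eta> \<in> alternating_forms p"
proof -
  have "linear (\<lambda>x. (\<omega> + \<eta>) (xs[i := x]))" if "i < length xs" for xs i
    using linear_compose_add[OF alternating_forms_linear[OF assms(1) that]
        alternating_forms_linear[OF assms(2) that]] by simp
  with assms show ?thesis
    unfolding alternating_forms_def by simp
qed

lemma alternating_forms_scale:
  assumes "\<omega> \<in> alternating_forms p"
  shows "scale_cochain c \<omega> \<in> alternating_forms p"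
proof -
  have "linear (\<lambda>x. c * f x)" if "linear f" for f :: "'a \<Rightarrow> real"
    using linear_compose_scale_right[OF that, of c] by simp
  then show ?thesis
    using assms unfolding alternating_forms_def scale_cochain_def by simp
qed

lemma subspace_alternating_forms: "cochain.subspace (alternating_forms p)"
  by (rule cochain.subspaceI)
     (auto simp: alternating_forms_add alternating_forms_scale,
      simp add: alternating_forms_def linear_zero)

lemma permute_list_transpose:
  assumes "a < length xs" "b < length xs"
  shows "permute_list (Transposition.transpose a b) xs = xs[a := xs ! b, b := xs ! a]"
  using assms
  by (intro nth_equalityI)
     (auto simp: permute_list_def nth_list_update Transposition.transpose_def)

lemma alternating_forms_swap:
  assumes \<omega>: "\<omega> \<in> alternating_forms p" and ab: "a < length xs" "b < length xs" "a \<noteq> b"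
  shows "\<omega> (permute_list (Transposition.transpose a b) xs) = - \<omega> xs"
proof -
  define f where "f u v = \<omega> (xs[a := u, b := v])" for u v
  have l1: "linear (\<lambda>v. f u v)" for u
    unfolding f_def using alternating_forms_linear[OF \<omega>, of b "xs[a := u]"] ab by simp
  have l2: "linear (\<lambda>u. f u v)" for v
    unfolding f_def
    using alternating_forms_linear[OF \<omega>, of a "xs[b := v]"] ab
    by (simp add: list_update_swap[of a b])
  have diag: "f u u = 0" for u
  proof -
    have "\<not> distinct (xs[a := u, b := u])"
      using ab nth_eq_iff_index_eq[of "xs[a := u, b := u]" a b] by auto
    then show ?thesis
      unfolding f_def using alternating_forms_not_distinct[OF \<omega>] by blast
  qed
  have "f (u + v) (u + v) = f u u + f u v + (f v u + f v v)" for u v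
    by (simp only: linear_add[OF l1] linear_add[OF l2] ac_simps)
  from this[of "xs ! a" "xs ! b"] have "f (xs ! b) (xs ! a) = - f (xs ! a) (xs ! b)"
    by (simp only: diag)
  then show ?thesis
    using ab by (simp add: f_def permute_list_transpose)
qed

text \<open>Only vanishing is carried through the decomposition into transpositions, which avoids
  signs and is enough for reducing equality of forms to increasing tuples.\<close>

lemma alternating_forms_permute_eq_0:
  assumes \<omega>: "\<omega> \<in> alternating_forms p" and "\<sigma> permutes {..<length xs}" and "\<omega> xs = 0"
  shows "\<omega> (permute_list \<sigma> xs) = 0"
proof (rule permutes_rev_induct[OF finite_lessThan assms(2)])
  show "\<omega> (permute_list id xs) = 0"
    by (simp add: assms)
next
  fix a b \<tau>
  assume swap: "a \<in> {..<length xs}" "b \<in> {..<length xs}" "a \<noteq> b"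
    "\<omega> (permute_list \<tau> xs) = 0" "\<tau> permutes {..<length xs}"
  have "permute_list (\<tau> \<circ> Transposition.transpose a b) xs
      = permute_list (Transposition.transpose a b) (permute_list \<tau> xs)"
    using swap by (intro permute_list_compose permutes_swap_id) auto
  then show "\<omega> (permute_list (\<tau> \<circ> Transposition.transpose a b) xs) = 0"
    using swap alternating_forms_swap[OF \<omega>, of a "permute_list \<tau> xs" b] by simp
qed

lemma alternating_forms_1D:
  "\<alpha> \<in> alternating_forms 1 \<Longrightarrow> linear (\<lambda>x. \<alpha> [x])"
  using alternating_forms_linear[of \<alpha> 1 0 "[undefined]"] by simp

lemma alternating_forms_2D:
  assumes "\<omega> \<in> alternating_forms 2"
  shows "linear (\<lambda>x. \<omega> [x, y])" "linear (\<lambda>y. \<omega> [x, y])" "\<omega> [x, x] = 0" "\<omega> [y, x] = - \<omega> [x, y]"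
proof -
  show l: "linear (\<lambda>x. \<omega> [x, y])" for y
    using alternating_forms_linear[OF assms, of 0 "[undefined, y]"] by simp
  show r: "linear (\<lambda>y. \<omega> [x, y])" for x
    using alternating_forms_linear[OF assms, of 1 "[x, undefined]"] by simp
  show diag: "\<omega> [x, x] = 0" for x
    using alternating_forms_not_distinct[OF assms, of "[x, x]"] by simp
  have "\<omega> [x + y, x + y] = \<omega> [x, x] + \<omega> [x, y] + (\<omega> [y, x] + \<omega> [y, y])"
    by (simp only: linear_add[OF l] linear_add[OF r] ac_simps)
  then show "\<omega> [y, x] = - \<omega> [x, y]"
    by (simp only: diag)
qed

lemma wedge_in_alternating_forms:
  assumes "\<And>\<phi>. \<phi> \<in> set \<phi>s \<Longrightarrow> linear \<phi>"
  shows "wedge \<phi>s \<in> alternating_forms (int (length \<phi>s))"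
  unfolding alternating_forms_def
proof (intro CollectI conjI allI impI)
  fix xs :: "'a list"
  let ?p = "length \<phi>s"
  show "wedge \<phi>s xs = 0" if "int (length xs) \<noteq> int ?p"
    using that by (simp add: wedge_def)
  show "linear (\<lambda>x. wedge \<phi>s (xs[i := x]))" if i: "i < length xs" for i
  proof (cases "length xs = ?p")
    case False
    then show ?thesis by (simp add: wedge_def linear_zero)
  next
    case True
    have "linear (\<lambda>x. of_int (sign \<sigma>) * (\<Prod>a<?p. (\<phi>s ! a) (xs[i := x] ! \<sigma> a)))"
      if \<sigma>: "\<sigma> permutes {..<?p}" for \<sigma>
    proof -
      \<comment> \<open>Exactly one factor of each product sees slot \<open>i\<close>, namely the
        one that \<sigma> sends there.\<close>
      obtain b where b: "b < ?p" "\<sigma> b = i"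
        using permutes_image[OF \<sigma>] i True by (metis imageE lessThan_iff)
      have "(\<Prod>a<?p. (\<phi>s ! a) (xs[i := x] ! \<sigma> a)) =
        (\<phi>s ! b) x * (\<Prod>a\<in>{..<?p} - {b}. (\<phi>s ! a) (xs ! \<sigma> a))" for x
      proof -
        have "(\<Prod>a\<in>{..<?p} - {b}. (\<phi>s ! a) (xs[i := x] ! \<sigma> a)) =
              (\<Prod>a\<in>{..<?p} - {b}. (\<phi>s ! a) (xs ! \<sigma> a))"
        proof (intro prod.cong refl)
          fix a assume "a \<in> {..<?p} - {b}"
          then have "\<sigma> a \<noteq> i"
            using b permutes_inj[OF \<sigma>] by (auto dest: injD)
          then show "(\<phi>s ! a) (xs[i := x] ! \<sigma> a) = (\<phi>s ! a) (xs ! \<sigma> a)"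
            by simp
        qed
        then show ?thesis
          using b i by (subst prod.remove[of _ b]) auto
      qed
      then have eq: "(\<lambda>x. of_int (sign \<sigma>) * (\<Prod>a<?p. (\<phi>s ! a) (xs[i := x] ! \<sigma> a))) =
        (\<lambda>x. (of_int (sign \<sigma>) * (\<Prod>a\<in>{..<?p} - {b}. (\<phi>s ! a) (xs ! \<sigma> a))) *\<^sub>R (\<phi>s ! b) x)"
        by (simp add: algebra_simps)
      show ?thesis
        unfolding eq using assms[of "\<phi>s ! b"] b(1)
        by (intro linear_compose_scale_right) auto
    qed
    then show ?thesis
      unfolding wedge_def using True by (auto intro!: linear_compose_sum)
  qed
  show "wedge \<phi>s xs = 0" if "\<not> distinct xs"
  proof (cases "length xs = ?p")
    case False
    then show ?thesis by (simp add: wedge_def)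
  next
    case True
    from that obtain i j where ij: "i < ?p" "j < ?p" "i \<noteq> j" "xs ! i = xs ! j"
      unfolding distinct_conv_nth True by blast
    let ?t = "Transposition.transpose i j"
    let ?f = "\<lambda>\<sigma>. of_int (sign \<sigma>) * (\<Prod>a<?p. (\<phi>s ! a) (xs ! \<sigma> a)) :: real"
    have t: "?t permutes {..<?p}"
      using ij by (intro permutes_swap_id) auto
    have xt: "xs ! ?t a = xs ! a" for a
      using ij by (auto simp: Transposition.transpose_def)
    \<comment> \<open>Composing with the transposition of the two equal entries flips the sign of
      each term, so the sum over all permutations is its own negative.\<close>
    have "?f (?t \<circ> \<sigma>) = - ?f \<sigma>" if \<sigma>: "\<sigma> permutes {..<?p}" for \<sigma>
    proof -
      have "sign (?t \<circ> \<sigma>) = - sign \<sigma>"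
        using ij permutes_imp_permutation[OF _ \<sigma>]
        by (subst sign_compose) (auto simp: permutation_swap_id sign_swap_id)
      then show ?thesis by (simp add: xt)
    qed
    then have "(\<Sum>\<sigma> | \<sigma> permutes {..<?p}. ?f (?t \<circ> \<sigma>)) = - (\<Sum>\<sigma> | \<sigma> permutes {..<?p}. ?f \<sigma>)"
      by (simp add: sum_negf[symmetric])
    then have "(\<Sum>\<sigma> | \<sigma> permutes {..<?p}. ?f \<sigma>) = 0"
      using setum_permutations_compose_left[OF t, of ?f] by simp
    then show ?thesis
      by (simp add: wedge_def True)
  qed
qed

section \<open>Coordinates, monomials and weights in an indexed basis\<close>

locale indexed_basis =
  fixes n :: nat and e :: "nat \<Rightarrow> 'a::real_vector"
  assumes inj: "inj_on e {1..n}"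
    and indep: "independent (e ` {1..n})"
    and spans: "span (e ` {1..n}) = UNIV"
begin

lemma linear_dual_basis: "linear (dual_basis n e i)"
proof -
  have "(scaleR :: real \<Rightarrow> real \<Rightarrow> real) = (*)"
    by (simp add: fun_eq_iff)
  then show ?thesis
    using real_vector.linear_representation[OF indep spans, of "e i"]
    unfolding dual_basis_def linear_def by simp
qed

lemma dual_basis_e:
  assumes "i \<in> {1..n}" "j \<in> {1..n}"
  shows "dual_basis n e i (e j) = (if i = j then 1 else 0)"
  unfolding dual_basis_def
  using assms inj_on_eq_iff[OF inj] by (subst real_vector.representation_basis[OF indep]) auto

lemma expansion: "x = (\<Sum>i=1..n. dual_basis n e i x *\<^sub>R e i)"
proof -
  have "x = (\<Sum>b\<in>e ` {1..n}. representation (e ` {1..n}) x b *\<^sub>R b)"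
    using real_vector.sum_representation_eq[OF indep, of x "e ` {1..n}"] spans by simp
  also have "\<dots> = (\<Sum>i=1..n. dual_basis n e i x *\<^sub>R e i)"
    unfolding dual_basis_def by (subst sum.reindex[OF inj]) simp
  finally show ?thesis .
qed

lemma linear_eq_0:
  assumes "linear f" "\<And>i. i \<in> {1..n} \<Longrightarrow> f (e i) = 0"
  shows "f x = 0"
  by (rule real_vector.linear_eq_0_on_span[OF assms(1), of "e ` {1..n}"])
     (use assms(2) spans in auto)

lemma multilinear_eq_0:
  assumes lin: "\<And>xs i. i < length xs \<Longrightarrow> linear (\<lambda>x. \<omega> (xs[i := x]))"
    and zero: "\<And>is. set is \<subseteq> {1..n} \<Longrightarrow> length is = length xs \<Longrightarrow> \<omega> (map e is) = 0"
  shows "\<omega> xs = 0"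
proof -
  \<comment> \<open>Arguments are replaced by basis vectors position by position; \<open>m\<close>
    counts the leading positions that are still arbitrary.\<close>
  have "\<omega> ys = 0" if "length ys = length xs" "m \<le> length xs" "\<forall>i\<in>{m..<length xs}. ys ! i \<in> e ` {1..n}"
    for m ys
    using that
  proof (induction m arbitrary: ys)
    case 0
    then have "set ys \<subseteq> e ` {1..n}"
      by (auto simp: in_set_conv_nth)
    then have "ys \<in> map e ` lists {1..n}"
      by (simp add: lists_image[symmetric] in_lists_conv_set subset_iff)
    then obtain is' where "ys = map e is'" "set is' \<subseteq> {1..n}"
      by (auto simp: in_lists_conv_set)
    then show ?case
      using zero[of is'] 0 by simp
  next
    case (Suc m)
    have "\<omega> (ys[m := x]) = 0" for x
    proof (rule linear_eq_0[where f = "\<lambda>x. \<omega> (ys[m := x])"])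
      show "linear (\<lambda>x. \<omega> (ys[m := x]))"
        using lin Suc.prems by simp
      show "\<omega> (ys[m := e i]) = 0" if "i \<in> {1..n}" for i
        using Suc.prems that by (intro Suc.IH) (auto simp: nth_list_update)
    qed
    from this[of "ys ! m"] show ?case by simp
  qed
  from this[of xs "length xs"] show ?thesis by simp
qed

text \<open>On basis vectors the difference of the two forms vanishes for repeated indices, and
  distinct indices are a permutation of an increasing list.\<close>

lemma alternating_forms_eqI:
  assumes \<omega>: "\<omega> \<in> alternating_forms p" and \<eta>: "\<eta> \<in> alternating_forms p"
    and eq: "\<And>is. sorted_wrt (<) is \<Longrightarrow> set is \<subseteq> {1..n} \<Longrightarrow> int (length is) = p \<Longrightarrow>
      \<omega> (map e is) = \<eta> (map e is)"
  shows "\<omega> = \<eta>"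
proof -
  define \<theta> where "\<theta> = \<omega> - \<eta>"
  have \<theta>: "\<theta> \<in> alternating_forms p"
    unfolding \<theta>_def using \<omega> \<eta> by (rule cochain.subspace_diff[OF subspace_alternating_forms])
  have "\<theta> xs = 0" for xs
  proof (rule multilinear_eq_0)
    show "linear (\<lambda>x. \<theta> (ys[i := x]))" if "i < length ys" for ys i
      using \<theta> that by (rule alternating_forms_linear)
    fix js assume js: "set js \<subseteq> {1..n}" "length js = length xs"
    show "\<theta> (map e js) = 0"
    proof (cases "distinct (map e js) \<and> int (length js) = p")
      case False
      then show ?thesis
        using alternating_forms_not_distinct[OF \<theta>] alternating_forms_length[OF \<theta>] by fastforce
    next
      case True
      then have "distinct js"
        by (simp add: distinct_map)
      then have "sorted_wrt (<) (sort js)"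
        by (simp add: strict_sorted_iff)
      then have "\<theta> (map e (sort js)) = 0"
        using eq[of "sort js"] js True by (simp add: \<theta>_def)
      moreover obtain \<sigma> where "\<sigma> permutes {..<length (sort js)}" "permute_list \<sigma> (sort js) = js"
        using mset_eq_permutation[of js "sort js"] by auto
      ultimately show ?thesis
        using alternating_forms_permute_eq_0[OF \<theta>, of \<sigma> "map e (sort js)"]
        by (simp add: permute_list_map)
    qed
  qed
  then show ?thesis
    by (simp add: \<theta>_def fun_eq_iff)
qed

text \<open>A non-zero term of the permutation sum would match each index of \<open>is\<close> with
  an equal index of \<open>js\<close>, making the two lists rearrangements of each other.\<close>

lemma wedge_dual_basis_eq_0:
  assumes "set is \<subseteq> {1..n}" "set js \<subseteq> {1..n}" "mset is \<noteq> mset js"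
  shows "wedge (map (dual_basis n e) is) (map e js) = 0"
proof (cases "length js = length is")
  case True
  have "(\<Prod>a<length is. dual_basis n e (is ! a) (map e js ! \<sigma> a)) = 0"
    if \<sigma>: "\<sigma> permutes {..<length is}" for \<sigma>
  proof (rule ccontr)
    have lt: "\<sigma> a < length is" if "a < length is" for a
      using permutes_in_image[OF \<sigma>] that by auto
    assume "\<not> ?thesis"
    then have "dual_basis n e (is ! a) (map e js ! \<sigma> a) \<noteq> 0" if "a < length is" for a
      using that by auto
    then have nz: "dual_basis n e (is ! a) (e (js ! \<sigma> a)) \<noteq> 0" if "a < length is" for a
      using that lt[OF that] True by (metis nth_map)
    have "is ! a = js ! \<sigma> a" if "a < length is" for a
    proof -
      have "is ! a \<in> {1..n}" "js ! \<sigma> a \<in> {1..n}"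
        using assms that lt[OF that] True nth_mem by (metis subsetD)+
      then show ?thesis
        using nz[OF that] dual_basis_e by metis
    qed
    then have "is = permute_list \<sigma> js"
      using True \<sigma> by (intro nth_equalityI) (auto simp: permute_list_nth)
    moreover have "mset (permute_list \<sigma> js) = mset js"
      using \<sigma> True by (intro mset_permute_list) simp
    ultimately show False
      using assms(3) by metis
  qed
  then show ?thesis
    by (simp add: wedge_def True sum.neutral del: prod_zero_iff)
qed (simp add: wedge_def)

lemma wedge_dual_basis_same:
  assumes "set is \<subseteq> {1..n}" "distinct is"
  shows "wedge (map (dual_basis n e) is) (map e is) = 1"
proof -
  have "of_int (sign \<sigma>) * (\<Prod>a<length is. dual_basis n e (is ! a) (map e is ! \<sigma> a)) =
        (if \<sigma> = id then 1 else 0 :: real)"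
    if \<sigma>: "\<sigma> permutes {..<length is}" for \<sigma>
  proof -
    have lt: "\<sigma> a < length is" if "a < length is" for a
      using permutes_in_image[OF \<sigma>] that by auto
    have mem: "is ! a \<in> {1..n}" if "a < length is" for a
      using assms that nth_mem by (metis subsetD)
    have val: "dual_basis n e (is ! a) (map e is ! \<sigma> a) = (if \<sigma> a = a then 1 else 0)"
      if "a < length is" for a
      using that lt[OF that] mem dual_basis_e assms(2) by (auto simp: nth_eq_iff_index_eq)
    show ?thesis
    proof (cases "\<sigma> = id")
      case True
      then show ?thesis using val by simp
    next
      case False
      then obtain a where "\<sigma> a \<noteq> a" by (auto simp: fun_eq_iff)
      moreover from this have "a < length is"
        using \<sigma> by (auto simp: permutes_def)
      ultimately have "\<exists>a<length is. dual_basis n e (is ! a) (map e is ! \<sigma> a) = 0"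
        using val by auto
      then have "(\<Prod>a<length is. dual_basis n e (is ! a) (map e is ! \<sigma> a)) = 0"
        by (intro prod_zero) auto
      with False show ?thesis by simp
    qed
  qed
  then have "wedge (map (dual_basis n e) is) (map e is) =
      (\<Sum>\<sigma> | \<sigma> permutes {..<length is}. if \<sigma> = id then 1 else 0)"
    by (simp add: wedge_def)
  also have "\<dots> = 1"
    by (simp add: finite_permutations permutes_id)
  finally show ?thesis .
qed

lemma weight_span_alternating:
  assumes "\<omega> \<in> cochain.span (monomials n e p P)"
  shows "\<omega> \<in> alternating_forms p"
proof -
  have "monomials n e p P \<subseteq> alternating_forms p"
  proof
    fix \<phi> assume "\<phi> \<in> monomials n e p P"
    then obtain "is" where "\<phi> = wedge (map (dual_basis n e) is)" "int (length is) = p"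
      by (auto simp: monomials_def)
    then show "\<phi> \<in> alternating_forms p"
      using wedge_in_alternating_forms[of "map (dual_basis n e) is"] linear_dual_basis by auto
  qed
  then show ?thesis
    using assms cochain.span_minimal[OF _ subspace_alternating_forms] by blast
qed

lemma weight_span_eq_0:
  assumes "\<omega> \<in> cochain.span (monomials n e p P)"
    and js: "set js \<subseteq> {1..n}" "\<not> P (int (sum_list js))"
  shows "\<omega> (map e js) = 0"
  using assms(1)
proof (induction rule: cochain.span_induct_alt)
  case base
  then show ?case by simp
next
  case (step c \<phi> \<eta>)
  then obtain "is" where "is": "\<phi> = wedge (map (dual_basis n e) is)" "set is \<subseteq> {1..n}"
    "P (int (sum_list is))"
    by (auto simp: monomials_def)
  have "mset is \<noteq> mset js"
    using "is"(3) js(2) by (metis sum_mset_sum_list)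
  then show ?case
    using step wedge_dual_basis_eq_0 "is" js by (simp add: scale_cochain_def)
qed

text \<open>The coefficient of a monomial is the value of \<omega> on the corresponding increasing
  basis tuple. One construction serves two ends: testing membership in a span of monomials, and
  projecting a form onto the weights selected by \<open>P\<close>.\<close>

lemma weight_component:
  obtains \<eta> where "\<eta> \<in> cochain.span (monomials n e p P)"
    "\<And>is. sorted_wrt (<) is \<Longrightarrow> set is \<subseteq> {1..n} \<Longrightarrow> int (length is) = p \<Longrightarrow>
      \<eta> (map e is) = (if P (int (sum_list is)) then \<omega> (map e is) else 0)"
proof
  let ?S = "{is. sorted_wrt (<) is \<and> set is \<subseteq> {1..n} \<and> int (length is) = p \<and> P (int (sum_list is))}"
  let ?\<eta> = "\<Sum>is\<in>?S. scale_cochain (\<omega> (map e is)) (wedge (map (dual_basis n e) is))"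
  have "finite {is. set is \<subseteq> {1..n} \<and> length is = nat p}"
    by (rule finite_lists_length_eq) simp
  then have fin: "finite ?S"
    by (rule rev_finite_subset) auto
  show "?\<eta> \<in> cochain.span (monomials n e p P)"
    by (intro cochain.span_sum cochain.span_scale cochain.span_base) (auto simp: monomials_def)
  fix js assume js: "sorted_wrt (<) js" "set js \<subseteq> {1..n}" "int (length js) = p"
  have apply_sum: "(\<Sum>i\<in>A. f i) x = (\<Sum>i\<in>A. f i x)" for f :: "nat list \<Rightarrow> 'a cochain" and A x
    by (induction A rule: infinite_finite_induct) auto
  have "?\<eta> (map e js) = (\<Sum>is\<in>?S. if is = js then \<omega> (map e js) else 0)"
    unfolding apply_sum
  proof (intro sum.cong refl)
    fix "is" assume "is": "is \<in> ?S"
    show "scale_cochain (\<omega> (map e is)) (wedge (map (dual_basis n e) is)) (map e js) =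
      (if is = js then \<omega> (map e js) else 0)"
    proof (cases "is = js")
      case True
      then show ?thesis
        using wedge_dual_basis_same[of js] js by (simp add: scale_cochain_def strict_sorted_iff)
    next
      case False
      then have "mset is \<noteq> mset js"
        using "is" js by (metis (mono_tags, lifting) mem_Collect_eq strict_sorted_iff
            properties_for_sort sort_key_id_if_sorted)
      then show ?thesis
        using wedge_dual_basis_eq_0[of "is" js] "is" js False by (simp add: scale_cochain_def)
    qed
  qed
  also have "\<dots> = (if P (int (sum_list js)) then \<omega> (map e js) else 0)"
    using js fin by (simp add: sum.delta)
  finally show "?\<eta> (map e js) = (if P (int (sum_list js)) then \<omega> (map e js) else 0)" .
qed

lemma weight_spanI:
  assumes \<omega>: "\<omega> \<in> alternating_forms p"
    and zero: "\<And>is. sorted_wrt (<) is \<Longrightarrow> set is \<subseteq> {1..n} \<Longrightarrow> int (length is) = p \<Longrightarrow>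
      \<not> P (int (sum_list is)) \<Longrightarrow> \<omega> (map e is) = 0"
  shows "\<omega> \<in> cochain.span (monomials n e p P)"
proof -
  obtain \<eta> where \<eta>: "\<eta> \<in> cochain.span (monomials n e p P)"
    "\<And>is. sorted_wrt (<) is \<Longrightarrow> set is \<subseteq> {1..n} \<Longrightarrow> int (length is) = p \<Longrightarrow>
      \<eta> (map e is) = (if P (int (sum_list is)) then \<omega> (map e is) else 0)"
    using weight_component by blast
  have "\<omega> = \<eta>"
    using \<omega> weight_span_alternating[OF \<eta>(1)] by (rule alternating_forms_eqI) (use \<eta>(2) zero in auto)
  with \<eta>(1) show ?thesis by simp
qed

end

section \<open>The differential in low degrees\<close>

lemma CE_diff_2: "CE_diff br \<omega> [x, y] = - \<omega> [br x y]"
  by (simp add: CE_diff_def nths_Cons lessThan_Suc)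

lemma CE_diff_3:
  "CE_diff br \<omega> [x, y, z] = - \<omega> [br x y, z] + \<omega> [br x z, y] - \<omega> [br y z, x]"
  by (simp add: CE_diff_def nths_Cons lessThan_Suc)

lemma CE_diff_eq_0_length:
  assumes "\<omega> \<in> alternating_forms p" "int (length xs) \<noteq> p + 1"
  shows "CE_diff br \<omega> xs = 0"
  unfolding CE_diff_def
proof (intro sum.neutral ballI)
  fix j i assume j: "j \<in> {..<length xs}" and i: "i \<in> {..<j}"
  have "{a. a < length xs \<and> a \<in> - {i, j}} = {..<length xs} - {i, j}"
    by auto
  then have "length (nths xs (- {i, j})) = length xs - 2"
    using i j by (simp add: length_nths card_Diff_subset)
  then have "int (length (br (xs ! i) (xs ! j) # nths xs (- {i, j}))) \<noteq> p"
    using assms(2) i j by auto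
  then have "\<omega> (br (xs ! i) (xs ! j) # nths xs (- {i, j})) = 0"
    by (rule alternating_forms_length[OF assms(1)])
  then show "(- 1) ^ (i + j) * \<omega> (br (xs ! i) (xs ! j) # nths xs (- {i, j})) = 0"
    by simp
qed

lemma CE_diff_diff: "CE_diff br (\<omega> - \<eta>) = CE_diff br \<omega> - CE_diff br \<eta>"
  by (simp add: CE_diff_def fun_eq_iff sum_subtractf algebra_simps)

text \<open>A common interface for \<open>br\<close> and its associated graded bracket, so that
  degree and alternation of the differential are treated once for both.\<close>

locale alternating_bracket =
  fixes br :: "'a::real_vector \<Rightarrow> 'a \<Rightarrow> 'a"
  assumes linear_right: "linear (\<lambda>y. br x y)"
    and linear_left: "linear (\<lambda>x. br x y)"
    and self: "br x x = 0"
begin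

lemma skew: "br y x = - br x y"
proof -
  have "br (x + y) (x + y) = br x x + br x y + (br y x + br y y)"
    by (simp only: linear_add[OF linear_left] linear_add[OF linear_right] ac_simps)
  then show ?thesis
    by (simp add: self eq_neg_iff_add_eq_0 add.commute)
qed

lemma CE_diff_1_alternating:
  assumes \<alpha>: "\<alpha> \<in> alternating_forms 1"
  shows "CE_diff br \<alpha> \<in> alternating_forms 2"
proof -
  note l = linear_compose[OF _ alternating_forms_1D[OF \<alpha>], unfolded o_def]
  have "CE_diff br \<alpha> xs = 0" if "int (length xs) \<noteq> 2" for xs
    using CE_diff_eq_0_length[OF \<alpha>] that by simp
  moreover have "linear (\<lambda>x. CE_diff br \<alpha> (xs[i := x]))" if i: "i < length xs" for xs i
  proof (cases "length xs = 2")
    case False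
    then show ?thesis
      using CE_diff_eq_0_length[OF \<alpha>] by (simp add: linear_zero)
  next
    case True
    then obtain a b where "xs = [a, b]"
      by (auto simp: numeral_2_eq_2 length_Suc_conv)
    then show ?thesis
      using i l[OF linear_left] l[OF linear_right]
      by (cases i) (auto simp: CE_diff_2 intro: linear_compose_neg)
  qed
  moreover have "CE_diff br \<alpha> xs = 0" if "\<not> distinct xs" for xs
  proof (cases "length xs = 2")
    case False
    then show ?thesis
      using CE_diff_eq_0_length[OF \<alpha>] by simp
  next
    case True
    then obtain a b where "xs = [a, b]"
      by (auto simp: numeral_2_eq_2 length_Suc_conv)
    then show ?thesis
      using that linear_0[OF alternating_forms_1D[OF \<alpha>]] by (simp add: CE_diff_2 self)
  qed
  ultimately show ?thesis
    unfolding alternating_forms_def by auto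
qed

lemma CE_diff_2_alternating:
  assumes \<omega>: "\<omega> \<in> alternating_forms 2"
  shows "CE_diff br \<omega> \<in> alternating_forms 3"
proof -
  note \<omega>2 = alternating_forms_2D[OF \<omega>]
  note l = linear_compose[OF _ \<omega>2(1), unfolded o_def]
  have "CE_diff br \<omega> xs = 0" if "int (length xs) \<noteq> 3" for xs
    using CE_diff_eq_0_length[OF \<omega>] that by simp
  moreover have "linear (\<lambda>x. CE_diff br \<omega> (xs[i := x]))" if i: "i < length xs" for xs i
  proof (cases "length xs = 3")
    case False
    then show ?thesis
      using CE_diff_eq_0_length[OF \<omega>] by (simp add: linear_zero)
  next
    case True
    then obtain a b c where xs: "xs = [a, b, c]"
      by (auto simp: numeral_3_eq_3 length_Suc_conv)
    have "linear (\<lambda>x. CE_diff br \<omega> [x, b, c])" "linear (\<lambda>x. CE_diff br \<omega> [a, x, c])"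
      "linear (\<lambda>x. CE_diff br \<omega> [a, b, x])"
      unfolding CE_diff_3
      by (rule linear_compose_add linear_compose_sub linear_compose_neg \<omega>2
          l[OF linear_left] l[OF linear_right])+
    moreover have "i = 0 \<or> i = 1 \<or> i = 2"
      using i xs by auto
    ultimately show ?thesis
      using xs by auto
  qed
  moreover have "CE_diff br \<omega> xs = 0" if "\<not> distinct xs" for xs
  proof (cases "length xs = 3")
    case False
    then show ?thesis
      using CE_diff_eq_0_length[OF \<omega>] by simp
  next
    case True
    then obtain a b c where "xs = [a, b, c]"
      by (auto simp: numeral_3_eq_3 length_Suc_conv)
    then show ?thesis
      using that linear_0[OF \<omega>2(1)] linear_neg[OF \<omega>2(1)] skew[of b a]
      by (auto simp: CE_diff_3 self)
  qed
  ultimately show ?thesis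
    unfolding alternating_forms_def by auto
qed

text \<open>The value on \<open>x, y, z\<close> is \<alpha> applied to minus the Jacobi sum.\<close>

lemma CE_diff_CE_diff_1:
  assumes jacobi: "\<And>x y z. br x (br y z) + br y (br z x) + br z (br x y) = 0"
    and \<alpha>: "\<alpha> \<in> alternating_forms 1"
  shows "CE_diff br (CE_diff br \<alpha>) = 0"
proof
  fix xs
  note l = alternating_forms_1D[OF \<alpha>]
  show "CE_diff br (CE_diff br \<alpha>) xs = 0 xs"
  proof (cases "length xs = 3")
    case False
    then show ?thesis
      using CE_diff_eq_0_length[OF CE_diff_1_alternating[OF \<alpha>]] by simp
  next
    case True
    then obtain x y z where xs: "xs = [x, y, z]"
      by (auto simp: numeral_3_eq_3 length_Suc_conv)
    have "CE_diff br (CE_diff br \<alpha>) xs =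
        \<alpha> [br (br x y) z] - \<alpha> [br (br x z) y] + \<alpha> [br (br y z) x]"
      by (simp add: xs CE_diff_3 CE_diff_2)
    also have "\<dots> = \<alpha> [br (br x y) z - br (br x z) y + br (br y z) x]"
      by (simp only: linear_add[OF l] linear_diff[OF l])
    also have "br (br x y) z - br (br x z) y + br (br y z) x =
        - (br x (br y z) + br y (br z x) + br z (br x y))"
      using skew[of "br x y" z] skew[of "br x z" y] skew[of "br y z" x] skew[of z x]
      by (simp add: linear_neg[OF linear_right])
    finally show ?thesis
      using linear_0[OF l] by (simp add: jacobi)
  qed
qed

end

section \<open>Two-forms through their Gram matrix\<close>

context indexed_basis
begin

text \<open>The condition ranges over all ordered pairs of indices, not only increasing ones, so
  that Gram entries can be used without comparing their indices.\<close>

lemma two_form_span_iff: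
  "\<omega> \<in> cochain.span (monomials n e 2 P) \<longleftrightarrow>
     \<omega> \<in> alternating_forms 2 \<and>
     (\<forall>i\<in>{1..n}. \<forall>j\<in>{1..n}. \<not> P (int (i + j)) \<longrightarrow> \<omega> [e i, e j] = 0)"
proof (intro iffI conjI ballI impI)
  assume \<omega>: "\<omega> \<in> cochain.span (monomials n e 2 P)"
  then show "\<omega> \<in> alternating_forms 2"
    by (rule weight_span_alternating)
  fix i j assume "i \<in> {1..n}" "j \<in> {1..n}" "\<not> P (int (i + j))"
  then show "\<omega> [e i, e j] = 0"
    using weight_span_eq_0[OF \<omega>, of "[i, j]"] by simp
next
  assume *: "\<omega> \<in> alternating_forms 2 \<and>
     (\<forall>i\<in>{1..n}. \<forall>j\<in>{1..n}. \<not> P (int (i + j)) \<longrightarrow> \<omega> [e i, e j] = 0)"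
  show "\<omega> \<in> cochain.span (monomials n e 2 P)"
  proof (rule weight_spanI)
    show "\<omega> \<in> alternating_forms 2" using * by blast
    fix "is" :: "nat list"
    assume "is": "set is \<subseteq> {1..n}" "int (length is) = 2" "\<not> P (int (sum_list is))"
    then have "length is = Suc (Suc 0)" by simp
    then obtain i j where "is = [i, j]"
      by (auto simp: length_Suc_conv)
    with "is" * show "\<omega> (map e is) = 0" by simp
  qed
qed

lemma three_form_spanI:
  assumes "\<omega> \<in> alternating_forms 3"
    and "\<And>i j l. i \<in> {1..n} \<Longrightarrow> j \<in> {1..n} \<Longrightarrow> l \<in> {1..n} \<Longrightarrow> \<not> P (int (i + j + l)) \<Longrightarrow>
      \<omega> [e i, e j, e l] = 0"
  shows "\<omega> \<in> cochain.span (monomials n e 3 P)"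
proof (rule weight_spanI)
  fix "is" :: "nat list"
  assume "is": "set is \<subseteq> {1..n}" "int (length is) = 3" "\<not> P (int (sum_list is))"
  then have "length is = Suc (Suc (Suc 0))" by simp
  then obtain i j l where "is = [i, j, l]"
    by (auto simp: length_Suc_conv)
  with "is" assms(2)[of i j l] show "\<omega> (map e is) = 0"
    by (simp add: add.assoc)
qed (fact assms(1))

lemma two_form_component:
  assumes \<omega>: "\<omega> \<in> alternating_forms 2"
  obtains \<eta> where "\<eta> \<in> cochain.span (monomials n e 2 P)"
    "\<And>i j. i \<in> {1..n} \<Longrightarrow> j \<in> {1..n} \<Longrightarrow>
      \<eta> [e i, e j] = (if P (int (i + j)) then \<omega> [e i, e j] else 0)"
proof -
  obtain \<eta> where \<eta>: "\<eta> \<in> cochain.span (monomials n e 2 P)"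
    "\<And>is. sorted_wrt (<) is \<Longrightarrow> set is \<subseteq> {1..n} \<Longrightarrow> int (length is) = 2 \<Longrightarrow>
      \<eta> (map e is) = (if P (int (sum_list is)) then \<omega> (map e is) else 0)"
    using weight_component by blast
  have \<eta>2: "\<eta> \<in> alternating_forms 2"
    using \<eta>(1) by (rule weight_span_alternating)
  have lt: "\<eta> [e i, e j] = (if P (int (i + j)) then \<omega> [e i, e j] else 0)"
    if "i \<in> {1..n}" "j \<in> {1..n}" "i < j" for i j
    using \<eta>(2)[of "[i, j]"] that by simp
  have "\<eta> [e i, e j] = (if P (int (i + j)) then \<omega> [e i, e j] else 0)"
    if "i \<in> {1..n}" "j \<in> {1..n}" for i j
  proof (cases i j rule: linorder_cases)
    case less
    then show ?thesis using lt that by simp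
  next
    case equal
    then show ?thesis
      using alternating_forms_2D(3)[OF \<omega>] alternating_forms_2D(3)[OF \<eta>2] by simp
  next
    case greater
    then show ?thesis
      using lt[of j i] that alternating_forms_2D(4)[OF \<omega>, of "e i" "e j"]
        alternating_forms_2D(4)[OF \<eta>2, of "e i" "e j"]
      by (simp add: add.commute[of j i])
  qed
  with \<eta>(1) show thesis by (rule that)
qed

text \<open>The Gram matrix is triangular with respect to the antidiagonal, so the coordinates of a
  kernel vector vanish one after the other: pairing with \<open>e (n + 1 - i)\<close> removes the
  coordinates after \<open>i\<close> by \<open>top\<close> and those before it by induction.\<close>

lemma nondegenerate_of_antidiagonal:
  assumes \<omega>: "\<omega> \<in> alternating_forms 2"
    and top: "\<And>i j. i \<in> {1..n} \<Longrightarrow> j \<in> {1..n} \<Longrightarrow> i + j > n + 1 \<Longrightarrow> \<omega> [e i, e j] = 0"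
    and anti: "\<And>i. i \<in> {1..n} \<Longrightarrow> \<omega> [e i, e (n + 1 - i)] \<noteq> 0"
  shows "nondegenerate \<omega>"
  unfolding nondegenerate_def
proof (intro allI impI)
  fix x assume x: "\<forall>y. \<omega> [x, y] = 0"
  have coord: "dual_basis n e i x = 0" if "i \<in> {1..n}" for i
    using that
  proof (induction i rule: less_induct)
    case (less i)
    note l = alternating_forms_2D(1)[OF \<omega>]
    have "0 = \<omega> [\<Sum>j=1..n. dual_basis n e j x *\<^sub>R e j, e (n + 1 - i)]"
      using x expansion[of x] by simp
    also have "\<dots> = (\<Sum>j=1..n. dual_basis n e j x * \<omega> [e j, e (n + 1 - i)])"
      by (simp add: linear_sum[OF l] linear_scale[OF l])
    also have "\<dots> = (\<Sum>j=1..n. if j = i then dual_basis n e i x * \<omega> [e i, e (n + 1 - i)] else 0)"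
    proof (intro sum.cong refl)
      fix j assume j: "j \<in> {1..n}"
      have "\<omega> [e j, e (n + 1 - i)] = 0" if "i < j"
        using that j less.prems by (intro top) auto
      with j show "dual_basis n e j x * \<omega> [e j, e (n + 1 - i)] =
        (if j = i then dual_basis n e i x * \<omega> [e i, e (n + 1 - i)] else 0)"
        using less.IH[of j] less.prems by (cases i j rule: linorder_cases) auto
    qed
    also have "\<dots> = dual_basis n e i x * \<omega> [e i, e (n + 1 - i)]"
      using less.prems by simp
    finally show ?case
      using anti[OF less.prems] by simp
  qed
  show "x = 0"
    by (subst expansion) (simp add: coord)
qed

lemma antidiagonal_of_nondegenerate:
  assumes \<omega>: "\<omega> \<in> alternating_forms 2"
    and top: "\<And>i j. i \<in> {1..n} \<Longrightarrow> j \<in> {1..n} \<Longrightarrow> i + j > n + 1 \<Longrightarrow> \<omega> [e i, e j] = 0"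
    and nondeg: "nondegenerate \<omega>" and i: "i \<in> {1..n}"
  shows "\<omega> [e i, e (n + 1 - i)] \<noteq> 0"
proof
  define Z where "Z = {i \<in> {1..n}. \<omega> [e i, e (n + 1 - i)] = 0}"
  assume "\<omega> [e i, e (n + 1 - i)] = 0"
  with i have "Z \<noteq> {}" "finite Z"
    unfolding Z_def by auto
  define i0 where "i0 = Max Z"
  \<comment> \<open>Below row \<open>i0\<close> the antidiagonal has no zero, so elimination with the rows
    \<open>i0 + 1, \<dots>, n\<close> turns \<open>e i0\<close> into a non-zero vector of the kernel.\<close>
  have i0: "i0 \<in> {1..n}" "\<omega> [e i0, e (n + 1 - i0)] = 0"
    using Max_in[OF \<open>finite Z\<close> \<open>Z \<noteq> {}\<close>] by (auto simp: i0_def Z_def)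
  have nz: "\<omega> [e m, e (n + 1 - m)] \<noteq> 0" if "m \<in> {1..n}" "m > i0" for m
  proof -
    have "m \<notin> Z"
      using Max_ge[OF \<open>finite Z\<close>, of m] that(2) by (auto simp: i0_def)
    with that(1) show ?thesis
      by (simp add: Z_def)
  qed
  note l = alternating_forms_2D(1)[OF \<omega>]
  \<comment> \<open>After the rows up to \<open>m\<close> the vector is orthogonal to the last
    \<open>m\<close> basis vectors. Its coordinate at \<open>i0\<close> stays 1, which keeps it
    non-zero.\<close>
  have "\<exists>x. dual_basis n e i0 x = 1 \<and> (\<forall>j\<in>{1..n}. n + 1 \<le> j + m \<longrightarrow> \<omega> [x, e j] = 0)"
    if "i0 \<le> m" "m \<le> n" for m
    using that
  proof (induction m rule: dec_induct)
    case base
    have "\<omega> [e i0, e j] = 0" if "j \<in> {1..n}" "n + 1 \<le> j + i0" for j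
    proof (cases "n + 1 = j + i0")
      case True
      then have "j = n + 1 - i0" by simp
      with i0 show ?thesis by simp
    next
      case False
      then show ?thesis
        using that top[of i0 j] i0 by simp
    qed
    then show ?case
      using i0 dual_basis_e by (intro exI[of _ "e i0"]) auto
  next
    case (step m)
    then obtain x where x: "dual_basis n e i0 x = 1"
      "\<And>j. j \<in> {1..n} \<Longrightarrow> n + 1 \<le> j + m \<Longrightarrow> \<omega> [x, e j] = 0"
      by auto
    \<comment> \<open>This factor clears column \<open>n - m\<close> with the antidiagonal entry of
      row \<open>Suc m\<close> as pivot; the columns further right stay cleared, because that row
      vanishes there by \<open>top\<close>.\<close>
    define t where "t = \<omega> [x, e (n - m)] / \<omega> [e (Suc m), e (n - m)]"
    have m: "Suc m \<in> {1..n}" "n + 1 - Suc m = n - m"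
      using step by auto
    have nzm: "\<omega> [e (Suc m), e (n - m)] \<noteq> 0"
      using nz[of "Suc m"] m step by simp
    have "\<omega> [x - t *\<^sub>R e (Suc m), e j] = 0" if j: "j \<in> {1..n}" "n + 1 \<le> j + Suc m" for j
    proof -
      have *: "\<omega> [x - t *\<^sub>R e (Suc m), e j] = \<omega> [x, e j] - t * \<omega> [e (Suc m), e j]"
        by (simp add: linear_diff[OF l] linear_scale[OF l])
      show ?thesis
      proof (cases "n + 1 = j + Suc m")
        case True
        then have "j = n - m" by simp
        with nzm show ?thesis
          unfolding * by (simp add: t_def)
      next
        case False
        then show ?thesis
          unfolding * using j x(2)[of j] top[of "Suc m" j] m by simp
      qed
    qed
    moreover have "dual_basis n e i0 (x - t *\<^sub>R e (Suc m)) = 1"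
      using x(1) dual_basis_e[OF i0(1) m(1)] step
      by (simp add: linear_diff[OF linear_dual_basis] linear_scale[OF linear_dual_basis])
    ultimately show ?case by blast
  qed
  from this[of n] obtain x where x: "dual_basis n e i0 x = 1" "\<And>j. j \<in> {1..n} \<Longrightarrow> \<omega> [x, e j] = 0"
    using i0 by auto
  have "\<omega> [x, y] = 0" for y
    using linear_eq_0[OF alternating_forms_2D(2)[OF \<omega>, of x]] x(2) by blast
  then have "x = 0"
    using nondeg by (auto simp: nondegenerate_def)
  with x(1) linear_0[OF linear_dual_basis] show False by simp
qed

end

section \<open>Adapted bases\<close>

locale adapted_lie_algebra =
  fixes br :: "'a::real_vector \<Rightarrow> 'a \<Rightarrow> 'a" and n :: nat and e :: "nat \<Rightarrow> 'a"
  assumes lie: "lie_algebra br" and adapted: "adapted_basis br n e"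

sublocale adapted_lie_algebra \<subseteq> indexed_basis n e
  using adapted by unfold_locales (auto simp: adapted_basis_def)

sublocale adapted_lie_algebra \<subseteq> alternating_bracket br
  using lie by (intro alternating_bracket.intro) (auto simp: lie_algebra_def)

context adapted_lie_algebra
begin

abbreviation "gr \<equiv> gr_bracket br n e"

lemma jacobi: "br x (br y z) + br y (br z x) + br z (br x y) = 0"
  using lie by (simp add: lie_algebra_def)

lemma br_e1: "2 \<le> i \<Longrightarrow> i + 1 \<le> n \<Longrightarrow> br (e 1) (e i) = e (i + 1)"
  using adapted by (simp add: adapted_basis_def)

lemma br_e_eq_0: "i \<in> {1..n} \<Longrightarrow> j \<in> {1..n} \<Longrightarrow> i + j > n \<Longrightarrow> br (e i) (e j) = 0"
  using adapted by (simp add: adapted_basis_def)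

lemma br_e:
  assumes "i \<in> {1..n}" "j \<in> {1..n}" "i + j \<le> n"
  obtains c :: "nat \<Rightarrow> real" where "br (e i) (e j) = (\<Sum>l=0..n-i-j. c l *\<^sub>R e (i + j + l))"
  using adapted assms unfolding adapted_basis_def by blast

section \<open>The graded bracket as the leading part of the bracket\<close>

lemma gr_e:
  assumes i: "i \<in> {1..n}" and j: "j \<in> {1..n}"
  shows "gr (e i) (e j) =
    (if i + j \<le> n then dual_basis n e (i + j) (br (e i) (e j)) *\<^sub>R e (i + j) else 0)"
proof -
  have "gr (e i) (e j) = (\<Sum>a\<in>{1..n}. if a = i then
      (\<Sum>b\<in>{1..n-i}. if b = j then
        dual_basis n e (i + j) (br (e i) (e j)) *\<^sub>R e (i + j) else 0) else 0)"
    unfolding gr_bracket_def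
  proof (intro sum.cong refl)
    fix a assume a: "a \<in> {1..n}"
    show "(\<Sum>b\<in>{1..n-a}. (dual_basis n e a (e i) * dual_basis n e b (e j) *
        dual_basis n e (a + b) (br (e a) (e b))) *\<^sub>R e (a + b)) =
      (if a = i then (\<Sum>b\<in>{1..n-i}. if b = j then
        dual_basis n e (i + j) (br (e i) (e j)) *\<^sub>R e (i + j) else 0) else 0)"
    proof (cases "a = i")
      case True
      have "dual_basis n e b (e j) = (if b = j then 1 else 0)" if "b \<in> {1..n-i}" for b
        using that j by (intro dual_basis_e) auto
      then have "(\<Sum>b\<in>{1..n-i}. (dual_basis n e i (e i) * dual_basis n e b (e j) *
          dual_basis n e (i + b) (br (e i) (e b))) *\<^sub>R e (i + b)) =
        (\<Sum>b\<in>{1..n-i}. if b = j then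
          dual_basis n e (i + j) (br (e i) (e j)) *\<^sub>R e (i + j) else 0)"
        using dual_basis_e[OF i i] by (intro sum.cong refl) simp
      then show ?thesis
        using True by simp
    next
      case False
      then show ?thesis
        using dual_basis_e[OF a i] by simp
    qed
  qed
  also have "\<dots> = (if i + j \<le> n then dual_basis n e (i + j) (br (e i) (e j)) *\<^sub>R e (i + j) else 0)"
    using i j by auto
  finally show ?thesis .
qed

lemma linear_gr_right: "linear (\<lambda>y. gr x y)"
  by (rule linearI)
     (simp_all add: gr_bracket_def linear_add[OF linear_dual_basis] linear_scale[OF linear_dual_basis]
       algebra_simps sum.distrib scaleR_sum_right)

lemma linear_gr_left: "linear (\<lambda>x. gr x y)"
  by (rule linearI)
     (simp_all add: gr_bracket_def linear_add[OF linear_dual_basis] linear_scale[OF linear_dual_basis]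
       algebra_simps sum.distrib scaleR_sum_right)

text \<open>Skewness is linear in each argument and can therefore be checked on basis vectors,
  unlike \<open>gr x x = 0\<close>, which follows from it on halving.\<close>

lemma gr_skew: "gr x y + gr y x = 0"
proof -
  have basis: "gr (e i) (e j) + gr (e j) (e i) = 0" if "i \<in> {1..n}" "j \<in> {1..n}" for i j
    using that skew[of "e j" "e i"]
    by (simp add: gr_e linear_neg[OF linear_dual_basis] add.commute[of j i])
  have "gr (e i) y + gr y (e i) = 0" if "i \<in> {1..n}" for i y
    using linear_compose_add[OF linear_gr_right linear_gr_left]
    by (rule linear_eq_0) (use basis that in auto)
  with linear_compose_add[OF linear_gr_left linear_gr_right]
  show ?thesis
    by (rule linear_eq_0)
qed

lemma gr_self: "gr x x = 0"
  using gr_skew[of x x] by (metis scaleR_2 scaleR_eq_0_iff zero_neq_numeral)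

sublocale gr: alternating_bracket gr
  by (intro alternating_bracket.intro linear_gr_left linear_gr_right gr_self)

text \<open>The two brackets of \<open>e i\<close> and \<open>e j\<close> differ by a combination of
  the \<open>e m\<close> with \<open>m > i + j\<close>, all invisible to \<open>f\<close>. In the
  applications \<open>f\<close> is a 2-form with its second slot fixed.\<close>

lemma br_leading_term:
  assumes i: "i \<in> {1..n}" and j: "j \<in> {1..n}" and f: "linear f"
    and zero: "\<And>m. m \<in> {1..n} \<Longrightarrow> m > i + j \<Longrightarrow> f (e m) = 0"
  shows "f (br (e i) (e j)) = f (gr (e i) (e j))"
proof (cases "i + j \<le> n")
  case False
  then show ?thesis
    using i j by (simp add: gr_e br_e_eq_0)
next
  case True
  obtain c where c: "br (e i) (e j) = (\<Sum>l=0..n-i-j. c l *\<^sub>R e (i + j + l))"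
    using br_e[OF i j True] .
  have lead: "g (br (e i) (e j)) = c 0 *\<^sub>R g (e (i + j))"
    if g: "linear g" "\<And>m. m \<in> {1..n} \<Longrightarrow> m > i + j \<Longrightarrow> g (e m) = 0" for g :: "'a \<Rightarrow> 'c::real_vector"
  proof -
    have "g (br (e i) (e j)) = (\<Sum>l=0..n-i-j. c l *\<^sub>R g (e (i + j + l)))"
      by (simp add: c linear_sum[OF g(1)] linear_scale[OF g(1)])
    also have "\<dots> = (\<Sum>l=0..n-i-j. if l = 0 then c 0 *\<^sub>R g (e (i + j)) else 0)"
      using i True by (intro sum.cong refl) (auto simp: g(2))
    finally show ?thesis by simp
  qed
  \<comment> \<open>The coordinate functional of \<open>e (i + j)\<close> also kills every later
    basis vector, so \<open>lead\<close> applies to it and identifies \<open>c 0\<close> with the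
    structure constant in \<open>gr\<close>.\<close>
  have "dual_basis n e (i + j) (br (e i) (e j)) = c 0 *\<^sub>R dual_basis n e (i + j) (e (i + j))"
    using i True by (intro lead linear_dual_basis) (simp add: dual_basis_e)
  then have "dual_basis n e (i + j) (br (e i) (e j)) = c 0"
    using i True by (simp add: dual_basis_e)
  then show ?thesis
    using lead[OF f zero] i j True by (simp add: gr_e linear_scale[OF f])
qed

lemma br_filtered:
  assumes i: "i \<in> {1..n}" and j: "j \<in> {1..n}" and f: "linear f"
    and zero: "\<And>m. m \<in> {1..n} \<Longrightarrow> m \<ge> i + j \<Longrightarrow> f (e m) = 0"
  shows "f (br (e i) (e j)) = 0"
proof -
  have "f (br (e i) (e j)) = f (gr (e i) (e j))"
    by (rule br_leading_term[OF i j f]) (simp add: zero)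
  then show ?thesis
    using i j linear_0[OF f] by (simp add: gr_e linear_scale[OF f] zero)
qed

section \<open>The differential and the weight filtration\<close>

text \<open>Brackets with \<open>i + j > n\<close> vanish, whatever \<alpha> is. So coboundaries
  never reach weight \<open>n + 1\<close>, which bounds the denominators of all pages at
  once.\<close>

lemma CE_diff_1_filtered:
  assumes \<alpha>: "\<alpha> \<in> alternating_forms 1"
  shows "CE_diff br \<alpha> \<in> weight_filtration n e (- int n) 2"
  unfolding weight_filtration_def two_form_span_iff
proof (intro conjI ballI impI)
  show "CE_diff br \<alpha> \<in> alternating_forms 2"
    using \<alpha> by (rule CE_diff_1_alternating)
  fix i j assume "i \<in> {1..n}" "j \<in> {1..n}" "\<not> int (i + j) \<le> - (- int n)"
  then show "CE_diff br \<alpha> [e i, e j] = 0"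
    using linear_0[OF alternating_forms_1D[OF \<alpha>]] by (simp add: CE_diff_2 br_e_eq_0)
qed

text \<open>A bracket never lowers the sum of the indices, so on a triple of index sum above
  \<open>- \<mu>\<close> each term of the differential evaluates the form on pairs of index sum
  above \<open>- \<mu>\<close>.\<close>

lemma CE_diff_2_filtered:
  assumes "\<omega> \<in> weight_filtration n e \<mu> 2"
  shows "CE_diff br \<omega> \<in> weight_filtration n e \<mu> 3"
proof -
  have \<omega>: "\<omega> \<in> alternating_forms 2"
    and top: "\<And>i j. i \<in> {1..n} \<Longrightarrow> j \<in> {1..n} \<Longrightarrow> int (i + j) > - \<mu> \<Longrightarrow> \<omega> [e i, e j] = 0"
    using assms unfolding weight_filtration_def two_form_span_iff by auto
  have zero: "\<omega> [br (e i) (e j), e l] = 0"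
    if "i \<in> {1..n}" "j \<in> {1..n}" "l \<in> {1..n}" "int (i + j + l) > - \<mu>" for i j l
    by (rule br_filtered[OF that(1,2) alternating_forms_2D(1)[OF \<omega>]], rule top) (use that in auto)
  show ?thesis
    unfolding weight_filtration_def
  proof (rule three_form_spanI)
    show "CE_diff br \<omega> \<in> alternating_forms 3"
      using \<omega> by (rule CE_diff_2_alternating)
    fix i j l
    assume "i \<in> {1..n}" "j \<in> {1..n}" "l \<in> {1..n}" "\<not> int (i + j + l) \<le> - \<mu>"
    then show "CE_diff br \<omega> [e i, e j, e l] = 0"
      using zero[of i j l] zero[of i l j] zero[of j l i] by (simp add: CE_diff_3)
  qed
qed

lemma closed_two_form_top_weight:
  assumes "even n" and \<omega>: "\<omega> \<in> alternating_forms 2" and closed: "CE_diff br \<omega> = 0"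
    and ij: "i \<in> {1..n}" "j \<in> {1..n}" "i + j > n + 1"
  shows "\<omega> [e i, e j] = 0"
proof -
  define w where "w = i + j"
  have w: "w \<ge> n + 2" "w - n \<ge> 2" "w - n \<le> n"
    using ij by (auto simp: w_def)
  note \<omega>2 = alternating_forms_2D[OF \<omega>]
  have cocycle: "- \<omega> [br x y, z] + \<omega> [br x z, y] - \<omega> [br y z, x] = 0" for x y z
    using closed CE_diff_3[of br \<omega> x y z] by simp
  \<comment> \<open>Along the antidiagonal of weight \<open>w\<close> the values alternate in sign, so a single zero makes
    all of them vanish: the diagonal entry if \<open>w = n + 2\<close>, and the end entry, by the cocycle
    identity with \<open>br (e 1) (e n) = 0\<close>, if \<open>w > n + 2\<close>.\<close>
  have shift: "\<omega> [e (Suc m), e (w - Suc m)] = - \<omega> [e m, e (w - m)]" if "w - n \<le> m" "Suc m \<le> n" for m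
  proof -
    have "br (e 1) (e m) = e (Suc m)" "br (e 1) (e (w - Suc m)) = e (w - m)"
      using br_e1[of m] br_e1[of "w - Suc m"] that w by (auto simp: Suc_diff_Suc)
    \<comment> \<open>The indices add up to \<open>w - 1\<close>, which exceeds \<open>n\<close>
      because \<open>w \<ge> n + 2\<close>. In weight \<open>n + 1\<close> this term could survive,
      and the argument stops there.\<close>
    moreover have "br (e m) (e (w - Suc m)) = 0"
      by (rule br_e_eq_0) (use that w in auto)
    ultimately show ?thesis
      using cocycle[of "e 1" "e m" "e (w - Suc m)"] \<omega>2(4)[of "e m" "e (w - m)"] linear_0[OF \<omega>2(1)]
      by simp
  qed
  have iff: "\<omega> [e m, e (w - m)] = 0 \<longleftrightarrow> \<omega> [e (w - n), e n] = 0" if "w - n \<le> m" "m \<le> n" for m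
    using that
  proof (induction m rule: dec_induct)
    case base
    then show ?case using w by simp
  next
    case (step m)
    then show ?case using shift[of m] by simp
  qed
  have "\<omega> [e (w - n), e n] = 0"
  proof (cases "w = n + 2")
    case True
    from \<open>even n\<close> obtain k where "n = 2 * k" by blast
    then have "w - n \<le> k + 1" "k + 1 \<le> n" "w - (k + 1) = k + 1"
      using w True by auto
    then show ?thesis
      using iff[of "k + 1"] \<omega>2(3) by simp
  next
    case False
    \<comment> \<open>Here \<open>e (w - n)\<close> is the bracket of \<open>e 1\<close> with the
      preceding basis vector. For \<open>w = n + 2\<close> it would be \<open>e 2\<close>, which is
      out of reach of \<open>br_e1\<close>; hence the separate case.\<close>
    then have "w - n - 1 + 1 = w - n" "2 \<le> w - n - 1"
      using w by auto
    then have "br (e 1) (e (w - n - 1)) = e (w - n)"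
      using br_e1[of "w - n - 1"] w(3) by simp
    moreover have "br (e 1) (e n) = 0" "br (e (w - n - 1)) (e n) = 0"
      using False w by (auto intro!: br_e_eq_0)
    ultimately show ?thesis
      using cocycle[of "e 1" "e (w - n - 1)" "e n"] linear_0[OF \<omega>2(1)] by simp
  qed
  then show ?thesis
    using iff[of i] ij by (auto simp: w_def)
qed

lemma gr_cohomology_class_eq: "gr_cohomology_class br n e 2 (int n + 1) \<omega> = {\<omega>}"
proof -
  have "monomials n e 1 (\<lambda>w. w = int n + 1) = {}"
    by (auto simp: monomials_def length_Suc_conv)
  then have "weight_forms n e 1 (int n + 1) = {0}"
    by (simp add: weight_forms_def)
  moreover have "CE_diff gr 0 = (0 :: 'a cochain)"
    using CE_diff_diff[of gr 0 0] by simp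
  ultimately show ?thesis
    by (simp add: gr_cohomology_class_def elt_set_plus_def)
qed

sublocale filtered_complex "weight_filtration n e" "CE_diff br"
proof
  fix p p' m :: int and x y :: "'a cochain"
  show "0 \<in> weight_filtration n e p m"
    by (simp add: weight_filtration_def cochain.span_zero)
  show "x - y \<in> weight_filtration n e p m"
    if "x \<in> weight_filtration n e p m" "y \<in> weight_filtration n e p m"
    using that by (simp add: weight_filtration_def cochain.span_diff)
  show "weight_filtration n e p' m \<subseteq> weight_filtration n e p m" if "p \<le> p'"
    unfolding weight_filtration_def
    by (rule cochain.span_mono) (use that in \<open>auto simp: monomials_def\<close>)
  show "CE_diff br (x - y) = CE_diff br x - CE_diff br y"
    by (rule CE_diff_diff)
qed

text \<open>The weight \<open>N\<close> part of the differential of \<omega> involves only the top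
  component of \<omega> and the leading part of the bracket: the corrections in \<open>br\<close>
  raise the index sum above \<open>N\<close>, where \<omega> vanishes. That part is thus the graded
  cocycle identity for \<eta>.\<close>

lemma top_component_closed:
  assumes \<omega>: "\<omega> \<in> alternating_forms 2" and closed: "CE_diff br \<omega> = 0"
    and top: "\<And>i j. i \<in> {1..n} \<Longrightarrow> j \<in> {1..n} \<Longrightarrow> i + j > N \<Longrightarrow> \<omega> [e i, e j] = 0"
    and \<eta>: "\<eta> \<in> alternating_forms 2"
    and comp: "\<And>i j. i \<in> {1..n} \<Longrightarrow> j \<in> {1..n} \<Longrightarrow>
      \<eta> [e i, e j] = (if i + j = N then \<omega> [e i, e j] else 0)"
  shows "CE_diff gr \<eta> = 0"
proof
  fix xs
  have bracket_term: "\<eta> [gr (e i) (e j), e l] = (if i + j + l = N then \<omega> [br (e i) (e j), e l] else 0)"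
    if "i \<in> {1..n}" "j \<in> {1..n}" "l \<in> {1..n}" for i j l
  proof -
    have "\<omega> [br (e i) (e j), e l] = \<omega> [gr (e i) (e j), e l]" if "i + j + l = N"
      by (rule br_leading_term[OF \<open>i \<in> {1..n}\<close> \<open>j \<in> {1..n}\<close> alternating_forms_2D(1)[OF \<omega>]], rule top)
         (use that \<open>l \<in> {1..n}\<close> in auto)
    then show ?thesis
      using that comp[of "i + j" l] linear_0[OF alternating_forms_2D(1)[OF \<eta>]]
        linear_0[OF alternating_forms_2D(1)[OF \<omega>]]
      by (auto simp: gr_e linear_scale[OF alternating_forms_2D(1)[OF \<eta>]]
          linear_scale[OF alternating_forms_2D(1)[OF \<omega>]])
  qed
  show "CE_diff gr \<eta> xs = 0 xs"
    unfolding zero_fun_apply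
  proof (rule multilinear_eq_0)
    show "linear (\<lambda>x. CE_diff gr \<eta> (ys[i := x]))" if "i < length ys" for ys i
      using gr.CE_diff_2_alternating[OF \<eta>] that by (rule alternating_forms_linear)
    fix "is" :: "nat list"
    assume "is": "set is \<subseteq> {1..n}"
    show "CE_diff gr \<eta> (map e is) = 0"
    proof (cases "length is = 3")
      case False
      then show ?thesis
        using CE_diff_eq_0_length[OF \<eta>] by simp
    next
      case True
      then obtain i j l where ijl: "is = [i, j, l]"
        by (auto simp: numeral_3_eq_3 length_Suc_conv)
      have "- \<omega> [br (e i) (e j), e l] + \<omega> [br (e i) (e l), e j] - \<omega> [br (e j) (e l), e i] = 0"
        using closed CE_diff_3[of br \<omega> "e i" "e j" "e l"] by simp
      then show ?thesis
        using "is" ijl by (simp add: CE_diff_3 bracket_term ac_simps)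
    qed
  qed
qed

section \<open>Symplectic forms and surviving classes of weight n + 1\<close>

lemma symplectic_iff_class_survives:
  assumes "even n"
  shows "symplectic br \<longleftrightarrow>
    (\<exists>\<omega>. \<omega> \<in> weight_forms n e 2 (int n + 1) \<and> CE_diff gr \<omega> = 0 \<and> nondegenerate \<omega> \<and>
       ss_survives (weight_filtration n e) (CE_diff br) (- int n - 1) (int n + 3)
         (ss_class (weight_filtration n e) (CE_diff br) 1 (- int n - 1) (int n + 3) \<omega>))"
    (is "_ \<longleftrightarrow> (\<exists>\<omega>. ?W \<omega> \<and> _ \<and> _ \<and> ss_survives ?F ?d ?p ?q (?c \<omega>))")
proof
  assume "symplectic br"
  then obtain \<omega> where \<omega>: "\<omega> \<in> alternating_forms 2" "nondegenerate \<omega>" "CE_diff br \<omega> = 0"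
    by (auto simp: symplectic_def)
  note top = closed_two_form_top_weight[OF \<open>even n\<close> \<omega>(1,3)]
  obtain \<eta> where W: "?W \<eta>"
    and comp: "\<And>i j. i \<in> {1..n} \<Longrightarrow> j \<in> {1..n} \<Longrightarrow>
      \<eta> [e i, e j] = (if int (i + j) = int n + 1 then \<omega> [e i, e j] else 0)"
    using two_form_component[OF \<omega>(1), of "\<lambda>w. w = int n + 1"] unfolding weight_forms_def by blast
  have comp': "\<eta> [e i, e j] = (if i + j = n + 1 then \<omega> [e i, e j] else 0)"
    if "i \<in> {1..n}" "j \<in> {1..n}" for i j
    using comp[OF that] by (simp add: of_nat_add[symmetric] of_nat_Suc[symmetric] del: of_nat_add of_nat_Suc)
  have \<eta>: "\<eta> \<in> alternating_forms 2"
    using W unfolding weight_forms_def by (rule weight_span_alternating)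
  have closed: "CE_diff gr \<eta> = 0"
    using top_component_closed[OF \<omega>(1,3) top \<eta> comp'] by simp
  have nondeg: "nondegenerate \<eta>"
  proof (rule nondegenerate_of_antidiagonal[OF \<eta>])
    show "\<eta> [e i, e (n + 1 - i)] \<noteq> 0" if "i \<in> {1..n}" for i
    proof -
      have "n + 1 - i \<in> {1..n}" "i + (n + 1 - i) = n + 1"
        using that by auto
      then show ?thesis
        using antidiagonal_of_nondegenerate[OF \<omega>(1) top \<omega>(2) that] comp'[OF that] by metis
    qed
  qed (simp add: comp')
  \<comment> \<open>The components of weight \<open>n + 1\<close> cancel and nothing heavier occurs,
    so the difference lies one filtration step beyond \<open>?p = - int n - 1\<close>. This
    identifies the classes of \<eta> and of the cocycle \<omega> on the first page.\<close>
  have "\<eta> - \<omega> \<in> ?F (- int n) 2"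
    unfolding weight_filtration_def two_form_span_iff
    using cochain.subspace_diff[OF subspace_alternating_forms \<eta> \<omega>(1)] comp' top by force
  then have "\<eta> - \<omega> \<in> ss_Z ?F ?d 0 (?p + 1) (?q - 1)"
    using CE_diff_2_filtered by (simp add: ss_Z_def)
  then have "\<eta> - \<omega> \<in> ss_B ?F ?d 1 ?p ?q"
    unfolding ss_B_iff using ss_Z_zero d_zero
    by (intro bexI[of _ "\<eta> - \<omega>"] bexI[of _ 0]) auto
  then have "?c \<eta> = ?c \<omega>"
    by (rule ss_class_eq)
  moreover have "ss_survives ?F ?d ?p ?q (?c \<omega>)"
  proof (rule ss_survives_of_cocycle[where m = 2])
    show "CE_diff br (CE_diff br \<alpha>) = 0" if "\<alpha> \<in> ?F p (2 - 1)" for p \<alpha>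
      using CE_diff_CE_diff_1[OF jacobi, of \<alpha>] weight_span_alternating[of \<alpha> 1] that
      by (simp add: weight_filtration_def)
    show "\<omega> \<in> ?F ?p 2"
      unfolding weight_filtration_def two_form_span_iff using \<omega>(1) top by force
  qed (use \<omega> in simp_all)
  ultimately show "\<exists>\<eta>. ?W \<eta> \<and> CE_diff gr \<eta> = 0 \<and> nondegenerate \<eta> \<and> ss_survives ?F ?d ?p ?q (?c \<eta>)"
    using W closed nondeg by auto
next
  assume "\<exists>\<omega>. ?W \<omega> \<and> CE_diff gr \<omega> = 0 \<and> nondegenerate \<omega> \<and> ss_survives ?F ?d ?p ?q (?c \<omega>)"
  then obtain \<omega> where W: "?W \<omega>" and nondeg: "nondegenerate \<omega>"
    and surv: "ss_survives ?F ?d ?p ?q (?c \<omega>)"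
    by blast
  have \<omega>: "\<omega> \<in> alternating_forms 2"
    and \<omega>0: "\<And>i j. i \<in> {1..n} \<Longrightarrow> j \<in> {1..n} \<Longrightarrow> i + j \<noteq> n + 1 \<Longrightarrow> \<omega> [e i, e j] = 0"
    using W unfolding weight_forms_def two_form_span_iff by force+
  \<comment> \<open>As \<open>- int n\<close> is \<open>?p + 1\<close>, this set contains the first
    summand of each \<open>ss_B\<close> at the position; it contains the second by
    \<open>CE_diff_1_filtered\<close>.\<close>
  let ?U = "?F (- int n) 2"
  have U_add: "x + y \<in> ?U" if "x \<in> ?U" "y \<in> ?U" for x y
    using that by (simp add: weight_filtration_def cochain.span_add)
  have B_U: "ss_B ?F ?d r ?p ?q \<subseteq> ?U" for r
  proof
    fix x assume "x \<in> ss_B ?F ?d r ?p ?q"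
    then obtain z \<alpha> where "z \<in> ?U" "\<alpha> \<in> ?F (?p - r + 1) 1" "x = z + CE_diff br \<alpha>"
      by (auto simp: ss_B_iff ss_Z_def)
    then show "x \<in> ?U"
      using U_add CE_diff_1_filtered weight_span_alternating[of \<alpha> 1]
      by (simp add: weight_filtration_def)
  qed
  \<comment> \<open>Going \<open>n + 2\<close> steps from \<open>?p = - int n - 1\<close> gives
    filtration index 1, that is weight at most -1, which no monomial has. This supplies the page
    \<open>N\<close> for \<open>cocycle_of_ss_survives\<close>.\<close>
  have "monomials n e 3 (\<lambda>w. w \<le> - 1) = {}"
    by (auto simp: monomials_def)
  then have F_0: "?F (?p + (int n + 2)) (?p + ?q + 1) \<subseteq> {0}"
    by (simp add: weight_filtration_def)
  obtain x where x: "x \<in> ?F ?p (?p + ?q)" "CE_diff br x = 0" "x - \<omega> \<in> ?U"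
    by (rule cocycle_of_ss_survives[OF surv U_add B_U _ F_0]) simp_all
  have x2: "x \<in> alternating_forms 2"
    and top: "\<And>i j. i \<in> {1..n} \<Longrightarrow> j \<in> {1..n} \<Longrightarrow> i + j > n + 1 \<Longrightarrow> x [e i, e j] = 0"
    using x(1) by (force simp: weight_filtration_def two_form_span_iff)+
  have "x [e i, e (n + 1 - i)] = \<omega> [e i, e (n + 1 - i)]" if "i \<in> {1..n}" for i
  proof -
    have "n + 1 - i \<in> {1..n}" "\<not> int (i + (n + 1 - i)) \<le> - (- int n)"
      using that by auto
    with that have "(x - \<omega>) [e i, e (n + 1 - i)] = 0"
      using x(3) unfolding weight_filtration_def two_form_span_iff by blast
    then show ?thesis by simp
  qed
  then have "nondegenerate x"
    using antidiagonal_of_nondegenerate[OF \<omega> \<omega>0 nondeg]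
    by (intro nondegenerate_of_antidiagonal[OF x2 top]) auto
  with x2 x(2) show "symplectic br"
    by (auto simp: symplectic_def)
qed

end

theorem theorem7p3:
  fixes k :: nat
    and br :: "'a::real_vector \<Rightarrow> 'a \<Rightarrow> 'a"
    and br0 :: "'b::real_vector \<Rightarrow> 'b \<Rightarrow> 'b"
    and G :: "nat \<Rightarrow> 'b set"
    and e :: "nat \<Rightarrow> 'a"
  assumes "filiform br (2 * k)"
    and "graded_filiform br0 (2 * k) G"
    and "symplectic br0"
    and "adapted_basis br (2 * k) e"
    and "gr_isomorphic br (2 * k) e br0 G"
  shows "symplectic br \<longleftrightarrow>
    (\<exists>c. homogeneous_symplectic_class br k e c \<and>
         ss_survives (weight_filtration (2 * k) e) (CE_diff br) (- 2 * int k - 1) (2 * int k + 3)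
           (gr_to_E1 br (2 * k) e (- 2 * int k - 1) (2 * int k + 3) c))"
proof -
  interpret adapted_lie_algebra br "2 * k" e
    using assms(1,4) by unfold_locales (auto simp: filiform_def)
  have class_eq: "gr_cohomology_class br (2 * k) e 2 (2 * int k + 1) \<omega> = {\<omega>}" for \<omega>
    using gr_cohomology_class_eq[of \<omega>] by simp
  \<comment> \<open>Since the classes of this weight are singletons, the quantifier over classes
    \<open>c\<close> turns into one over forms.\<close>
  have hom: "homogeneous_symplectic_class br k e c \<longleftrightarrow>
    (\<exists>\<omega>. c = {\<omega>} \<and> \<omega> \<in> weight_forms (2 * k) e 2 (2 * int k + 1) \<and>
      CE_diff gr \<omega> = 0 \<and> nondegenerate \<omega>)" for c
    unfolding homogeneous_symplectic_class_def gr_cohomology_def class_eq by auto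
  have E1: "gr_to_E1 br (2 * k) e p q {\<omega>} =
      ss_class (weight_filtration (2 * k) e) (CE_diff br) 1 p q \<omega>" for p q \<omega>
    by (simp add: gr_to_E1_def)
  have int_eqs: "- 2 * int k - 1 = - int (2 * k) - 1" "2 * int k + 3 = int (2 * k) + 3"
    "2 * int k + 1 = int (2 * k) + 1"
    by simp_all
  have "symplectic br \<longleftrightarrow> (\<exists>\<omega>. \<omega> \<in> weight_forms (2 * k) e 2 (2 * int k + 1) \<and>
      CE_diff gr \<omega> = 0 \<and> nondegenerate \<omega> \<and>
      ss_survives (weight_filtration (2 * k) e) (CE_diff br) (- 2 * int k - 1) (2 * int k + 3)
        (gr_to_E1 br (2 * k) e (- 2 * int k - 1) (2 * int k + 3) {\<omega>}))"
    unfolding E1 int_eqs by (rule symplectic_iff_class_survives) simp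
  then show ?thesis
    unfolding hom by blast
qed

end
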